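(* Let $\alpha_1,\ldots,\alpha_n$ be ordinal numbers such that $(\alpha_1,\ldots,\alpha_n)$ is a position in Transfinite Welter's Game. Then its Grundy value equals its Welter function: $$\mathcal{G}(\alpha_1,\ldots,\alpha_n)=[\alpha_1|\cdots|\alpha_n].$$
   Context: Transfinite Welter's Game: finitely many coins are placed on a belt of squares numbered by the ordinal numbers, at most one coin per square. A position with $n$ coins is $(\alpha_1,\ldots,\alpha_n)$, where the $\alpha_i$ are pairwise distinct ordinals (the squares occupied by the coins). Two players move alternately. A legal move moves one coin from its present square $\alpha_i$ to any unoccupied square with a strictly smaller ordinal number (jumping over other coins is allowed). A player unable to move loses (normal play). Grundy value: write $G\to G'$ if $G'$ can be reached from $G$ by a single legal move. For a proper subclass $T$ of the class $\mathcal{ON}$ of all ordinals, $\mathrm{mex}\,T=\min(\mathcal{ON}\setminus T)$. The Grundy value is defined recursively by $\mathcal{G}(G)=0$ if $G$ is an end position (no legal moves) and $\mathcal{G}(G)=\mathrm{mex}\{\mathcal{G}(G')\mid G\to G'\}$ otherwise. Nim-sum: for nonnegative integers, $m_1\oplus\cdots\oplus m_n$ is binary addition without carry (bitwise XOR). For ordinals $\alpha_1,\ldots,\alpha_n$, write them with finitely many common exponents $\gamma_k>\cdots>\gamma_1>\gamma_0\ge 0$ in Cantor normal form with zero coefficients allowed, $\alpha_i=\omega^{\gamma_k}\cdot m_{ik}+\cdots+\omega^{\gamma_1}\cdot m_{i1}+\omega^{\gamma_0}\cdot m_{i0}$ with $m_{ij}\in\mathbb{N}_0$. Then $\alpha_1\oplus\cdots\oplus\alpha_n=\omega^{\gamma_k}\cdot(m_{1k}\oplus\cdots\oplus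 m_{nk})+\cdots+\omega^{\gamma_0}\cdot(m_{10}\oplus\cdots\oplus m_{n0})$. The symbol $\sum^{\oplus}$ denotes nim-summation. Welter function on finite positions: for distinct nonnegative integers $x\ne y$, the mating function is $(x\mid y)=2^{r+1}-1$, where $r\ge 0$ is the integer with $x\equiv y \pmod{2^r}$ and $x\not\equiv y\pmod{2^{r+1}}$. For a finite set $\{a_1,\ldots,a_p\}$ of distinct nonnegative integers, $[a_1|\cdots|a_p]=a_1\oplus\cdots\oplus a_p\oplus\sum^{\oplus}_{1\le i<j\le p}(a_i\mid a_j)$. For the empty set the value is $0$. Welter function on ordinals: write each $\alpha_i$ uniquely as $\alpha_i=\omega\cdot\lambda_i+m_i$ with $\lambda_i\in\mathcal{ON}$ and $m_i\in\mathbb{N}_0$. For each ordinal $\lambda$ let $S_\lambda=\{m_i\mid \lambda_i=\lambda\}$, and let $[S_\lambda]$ be the Welter function of this finite set of nonnegative integers. Then $$[\alpha_1|\cdots|\alpha_n]=\omega\cdot(\lambda_1\oplus\cdots\oplus\lambda_n)+\sum_{\lambda\in\mathcal{ON}}^{\oplus}[S_\lambda],$$ where only finitely many $S_\lambda$ are nonempty. *)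

theory Defs
  imports "HOL-Number_Theory.Cong"
begin

unbundle cardinal_syntax

subsection \<open>Ordinals\<close>

text \<open>
  HOL has no type of all ordinals. The type \<open>'a ordinal\<close> consists of the order types of all
  well-orders on subsets of \<open>'a + nat\<close>, that is, of all ordinals below the successor cardinal
  of \<open>|'a + nat|\<close>. Every well-order in HOL has an order type of this kind for a suitable
  \<open>'a\<close>. As \<open>'a + nat\<close> is infinite, the type is closed under the usual ordinal arithmetic, and
  every subset with at most \<open>|'a + nat|\<close> elements, in particular the image of every proper
  initial segment, is bounded in it. So the suprema and \<open>mex\<close> values used below are those
  taken in the class of all ordinals.
\<close>

quotient_type 'a ordinal = "('a + nat) rel" / partial: "\<lambda>r s. r =o s"
proof (rule part_equivpI)
  have "({} :: ('a + nat) rel) =o ({} :: ('a + nat) rel)"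
    by (rule ordIso_reflexive) (simp add: Field_def)
  then show "\<exists>r :: ('a + nat) rel. r =o r" by blast
qed (auto intro: sympI transpI ordIso_symmetric ordIso_transitive)

lemma ordIso_refl_iff: "r =o r \<longleftrightarrow> Well_order r"
  by (metis ordIso_iff_ordLeq ordLeq_Well_order_simp ordLeq_reflexive)

lemma abs_ordinal_eqI: "r =o s \<Longrightarrow> abs_ordinal r = abs_ordinal s"
  by (rule Quotient_rel_abs[OF Quotient_ordinal])

lemma ordinal_cases:
  obtains r where "a = abs_ordinal r" "Well_order r"
  using Quotient_abs_rep[OF Quotient_ordinal, of a] Quotient_rep_reflp[OF Quotient_ordinal, of a]
  by (metis ordIso_refl_iff)

instantiation ordinal :: (type) wellorder
begin

lift_definition less_eq_ordinal :: "'a ordinal \<Rightarrow> 'a ordinal \<Rightarrow> bool" is "\<lambda>r s. r \<le>o s"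
  by (meson ordIso_ordLeq_trans ordIso_symmetric ordLeq_ordIso_trans)

lift_definition less_ordinal :: "'a ordinal \<Rightarrow> 'a ordinal \<Rightarrow> bool" is "\<lambda>r s. r <o s"
  by (meson ordIso_ordLess_trans ordIso_symmetric ordLess_ordIso_trans)

instance
proof
  fix x y z :: "'a ordinal"
  show "x < y \<longleftrightarrow> x \<le> y \<and> \<not> y \<le> x"
    by transfer (metis not_ordLess_ordLeq not_ordLeq_ordLess ordLess_imp_ordLeq ordLess_or_ordLeq ordIso_refl_iff)
  show "x \<le> x" by transfer (simp add: ordIso_refl_iff ordLeq_reflexive)
  show "x \<le> y \<Longrightarrow> y \<le> z \<Longrightarrow> x \<le> z" by transfer (rule ordLeq_transitive)
  show "x \<le> y \<Longrightarrow> y \<le> x \<Longrightarrow> x = y" by transfer (simp add: ordIso_iff_ordLeq)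
  show "x \<le> y \<or> y \<le> x" by transfer (simp add: ordIso_refl_iff ordLeq_total)
next
  fix P :: "'a ordinal \<Rightarrow> bool" and a
  assume step: "\<And>x. (\<And>y. y < x \<Longrightarrow> P y) \<Longrightarrow> P x"
  have "wf {(x, y :: 'a ordinal). x < y}"
  proof (rule wf_subset)
    show "wf (inv_image ordLess (rep_ordinal :: 'a ordinal \<Rightarrow> _))"
      by (intro wf_inv_image wf_ordLess)
    show "{(x, y :: 'a ordinal). x < y} \<subseteq> inv_image ordLess rep_ordinal"
      by (auto simp: less_ordinal_def)
  qed
  then show "P a" by (induction a rule: wf_induct_rule) (use step in auto)
qed

end

instantiation ordinal :: (type) conditionally_complete_linorder
begin

definition Inf_ordinal :: "'a ordinal set \<Rightarrow> 'a ordinal" where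
  "Inf_ordinal A = (LEAST x. x \<in> A)"

definition Sup_ordinal :: "'a ordinal set \<Rightarrow> 'a ordinal" where
  "Sup_ordinal A = (LEAST x. \<forall>a\<in>A. a \<le> x)"

definition "inf_ordinal = (min :: 'a ordinal \<Rightarrow> _)"
definition "sup_ordinal = (max :: 'a ordinal \<Rightarrow> _)"

instance
proof
  fix A :: "'a ordinal set" and x z :: "'a ordinal"
  show "x \<in> A \<Longrightarrow> bdd_below A \<Longrightarrow> Inf A \<le> x"
    by (simp add: Inf_ordinal_def Least_le)
  show "A \<noteq> {} \<Longrightarrow> (\<And>x. x \<in> A \<Longrightarrow> z \<le> x) \<Longrightarrow> z \<le> Inf A"
    by (metis Inf_ordinal_def LeastI ex_in_conv)
  show "x \<in> A \<Longrightarrow> bdd_above A \<Longrightarrow> x \<le> Sup A"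
    unfolding Sup_ordinal_def bdd_above_def
    using LeastI_ex[of "\<lambda>x. \<forall>a\<in>A. a \<le> x"] by blast
  show "A \<noteq> {} \<Longrightarrow> (\<And>x. x \<in> A \<Longrightarrow> x \<le> z) \<Longrightarrow> Sup A \<le> z"
    unfolding Sup_ordinal_def by (rule Least_le) blast
qed (simp_all add: inf_ordinal_def sup_ordinal_def)

end

lemma ordinal_initial_segment:
  fixes r :: "('a + nat) rel"
  assumes r: "Well_order r"
  defines "h \<equiv> \<lambda>x. abs_ordinal (Restr r (underS r x))"
  shows "bij_betw h (Field r) {..<abs_ordinal r}"
    and "\<And>x y. (x, y) \<in> r \<Longrightarrow> x \<noteq> y \<Longrightarrow> h x < h y"
proof -
  have WR: "Well_order (Restr r A)" for A
    using r by (rule Well_order_Restr)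
  have less: "abs_ordinal s < abs_ordinal t \<longleftrightarrow> s <o t"
    if "Well_order s" "Well_order t" for s t :: "('a + nat) rel"
    using that by (simp add: less_ordinal.abs_eq ordIso_refl_iff)
  have wo: "wo_rel r" using r by (simp add: wo_rel_def)
  note TRANS = wo_rel.TRANS[OF wo] and ANTISYM = wo_rel.ANTISYM[OF wo]
    and TOTALS = wo_rel.TOTALS[OF wo] and underS_ofilter = wo_rel.underS_ofilter[OF wo]
  show *: "h x < h y" if "(x, y) \<in> r" "x \<noteq> y" for x y
  proof -
    have "underS r x \<subset> underS r y"
      using that r underS_incr[OF TRANS ANTISYM]
      by (auto simp: underS_def dest: antisymD[OF ANTISYM])
        
    then show ?thesis
      unfolding h_def less[OF WR WR]
      using ofilter_subset_ordLess[OF r] underS_ofilter by blast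
  qed
  show "bij_betw h (Field r) {..<abs_ordinal r}"
    unfolding bij_betw_def
  proof
    show "inj_on h (Field r)"
      by (smt (verit) "*" inj_onI less_irrefl TOTALS)
    show "h ` Field r = {..<abs_ordinal r}"
    proof safe
      fix x assume "x \<in> Field r"
      then show "h x < abs_ordinal r"
        unfolding h_def less[OF WR r] using r underS_Restr_ordLess by fastforce
    next
      fix b assume "b < abs_ordinal r"
      moreover obtain s where s: "b = abs_ordinal s" "Well_order s"
        by (rule ordinal_cases)
      ultimately have "s <o r" by (simp add: less r)
      then obtain a where "a \<in> Field r" "s =o Restr r (underS r a)"
        using ordLess_iff_ordIso_Restr[OF r s(2)] by blast
      then show "b \<in> h ` Field r"
        unfolding h_def s by (auto dest: abs_ordinal_eqI)
    qed
  qed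
qed

lemma no_inj_ordinal: "\<not> inj (e :: 'a ordinal \<Rightarrow> 'a + nat)"
proof
  assume e: "inj e"
  define R where "R = {(x, y :: 'a ordinal). x \<le> y}"
  have FR: "Field R = UNIV" by (auto simp: R_def Field_def)
  have "R - Id = {(x, y). x < y}" by (auto simp: R_def)
  then have "wf (R - Id)" by (simp add: wellorder_class.wf)
  moreover have "refl R" "trans R" "antisym R" "total R"
    by (auto simp: R_def intro: reflI transI antisymI totalI)
  ultimately have WR: "Well_order R"
    by (simp add: well_order_on_def linear_order_on_def partial_order_on_def
        preorder_on_def FR)
  define r where "r = dir_image R e"
  have Wr: "Well_order r"
    unfolding r_def using WR e by (intro Well_order_dir_image) (auto simp: FR)
  have Fr: "e b \<in> Field r" for b unfolding r_def by (simp add: dir_image_Field FR)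
  define h where "h x = abs_ordinal (Restr r (underS r x))" for x
  define k where "k b = h (e b)" for b
  have mono: "k b < k c" if "b < c" for b c
    unfolding k_def h_def
  proof (rule ordinal_initial_segment(2)[OF Wr])
    show "(e b, e c) \<in> r" using less_imp_le[OF that] by (auto simp: r_def dir_image_def R_def)
    show "e b \<noteq> e c" using that e by (auto dest: injD)
  qed
  have "k b < abs_ordinal r" for b
    using ordinal_initial_segment(1)[OF Wr] Fr[of b]
    by (auto simp: k_def h_def bij_betw_def)
  then have "\<exists>b. k b < b" by blast
  then show False
    using mono LeastI_ex[of "\<lambda>b. k b < b"] not_less_Least[of _ "\<lambda>b. k b < b"] by blast
qed

lemma ordinal_small_bdd_above:
  fixes f :: "'a + nat \<Rightarrow> 'a ordinal"
  assumes A: "A \<subseteq> range f"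
  shows "bdd_above A"
proof (rule ccontr)
  assume "\<not> bdd_above A"
  then have "\<exists>i. b < f i" for b
    using A by (metis bdd_above.I image_iff linorder_not_less subsetD rangeE)
  then obtain i where i: "\<And>b. b < f (i b)" by metis
  have seg: "\<exists>g :: 'a ordinal \<Rightarrow> 'a + nat. inj_on g {..<a}" for a
  proof -
    obtain r where r: "a = abs_ordinal r" "Well_order r"
      by (rule ordinal_cases)
    show ?thesis
      using ordinal_initial_segment(1)[OF r(2)] bij_betw_inv_into bij_betw_imp_inj_on r(1) by blast
  qed
  then obtain g :: "'a ordinal \<Rightarrow> 'a ordinal \<Rightarrow> 'a + nat" where g: "\<And>a. inj_on (g a) {..<a}"
    by metis
  have "infinite (UNIV :: ('a + nat) set)" by simp
  then have "|(UNIV :: ('a + nat) set) \<times> (UNIV :: ('a + nat) set)| =o |UNIV :: ('a + nat) set|"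
    by (rule card_of_Times_same_infinite)
  then obtain p :: "('a + nat) \<times> ('a + nat) \<Rightarrow> 'a + nat" where p: "inj p"
    by (metis UNIV_Times_UNIV bij_betw_imp_inj_on card_of_ordIso)
  define e where "e b = p (i b, g (f (i b)) b)" for b
  have "inj e"
  proof (rule injI)
    fix b c assume "e b = e c"
    then have "i b = i c" "g (f (i b)) b = g (f (i c)) c"
      using p by (auto simp: e_def dest: injD)
    then show "b = c" using g[of "f (i b)"] i[of b] i[of c] by (auto dest: inj_onD)
  qed
  with no_inj_ordinal show False by (rule notE)
qed

lemma bdd_above_image_lessThan [simp, intro]: "bdd_above (F ` {..<a})"
  for F :: "'a ordinal \<Rightarrow> 'a ordinal" and a :: "'a ordinal"
proof -
  obtain r where r: "a = abs_ordinal r" "Well_order r"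
    by (rule ordinal_cases)
  obtain h where "bij_betw h (Field r) {..<a}"
    using ordinal_initial_segment(1)[OF r(2)] r(1) by blast
  then have "F ` {..<a} \<subseteq> range (F \<circ> h)"
    unfolding bij_betw_def by (metis image_comp image_mono subset_UNIV)
  then show ?thesis by (rule ordinal_small_bdd_above)
qed

lemma ordinal_no_top: "\<exists>b. a < b" for a :: "'a ordinal"
proof (rule ccontr)
  assume "\<nexists>b. a < b"
  then have top: "b \<le> a" for b by (simp add: not_less)
  obtain r where r: "a = abs_ordinal r" "Well_order r" by (rule ordinal_cases)
  define g where "g = inv_into (Field r) (\<lambda>x. abs_ordinal (Restr r (underS r x)))"
  have g: "inj_on g {..<a}"
    unfolding g_def r(1)
    using ordinal_initial_segment(1)[OF r(2)] bij_betw_inv_into bij_betw_imp_inj_on by blast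
  define shift :: "'a + nat \<Rightarrow> 'a + nat" where "shift = map_sum id Suc"
  have "inj shift" unfolding shift_def by (intro sum.inj_map) simp_all
  moreover have "shift x \<noteq> Inr 0" for x by (cases x) (simp_all add: shift_def)
  ultimately have shift: "shift x = shift y \<longleftrightarrow> x = y" "shift x \<noteq> Inr 0" "Inr 0 \<noteq> shift x" for x y
    by (simp_all add: inj_eq) metis
  define e where "e b = (if b = a then Inr 0 else shift (g b))" for b
  have "inj e"
  proof (rule injI)
    fix b c assume "e b = e c"
    then show "b = c"
      using inj_onD[OF g, of b c] top[of b] top[of c]
      by (auto simp: e_def shift order_less_le split: if_splits)
  qed
  with no_inj_ordinal show False by (rule notE)
qed

unbundle no cardinal_syntax

subsection \<open>Ordinal arithmetic\<close>

text \<open>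
  Sums, products and powers of omega are defined by transfinite recursion, each with a single
  supremum; the usual clauses for zero, successor and limit arguments are derived below.
\<close>

definition ord_succ :: "'a ordinal \<Rightarrow> 'a ordinal" where
  "ord_succ a = (LEAST b. a < b)"

declare image_cong [fundef_cong]

instantiation ordinal :: (type) "{zero, one, plus, times}"
begin

definition zero_ordinal :: "'a ordinal" where
  "zero_ordinal = (LEAST x. True)"

definition one_ordinal :: "'a ordinal" where
  "one_ordinal = ord_succ (0 :: 'a ordinal)"

function plus_ordinal :: "'a ordinal \<Rightarrow> 'a ordinal \<Rightarrow> 'a ordinal" where
  "plus_ordinal a b = Sup (insert a ((\<lambda>c. ord_succ (plus_ordinal a c)) ` {..<b}))"
  by auto
termination
  by (relation "inv_image {(x, y). x < y} snd") (simp_all add: wellorder_class.wf)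
declare plus_ordinal.simps [simp del]

function times_ordinal :: "'a ordinal \<Rightarrow> 'a ordinal \<Rightarrow> 'a ordinal" where
  "times_ordinal a b = Sup ((\<lambda>c. times_ordinal a c + a) ` {..<b})"
  by auto
termination
  by (relation "inv_image {(x, y). x < y} snd") (simp_all add: wellorder_class.wf)
declare times_ordinal.simps [simp del]

instance ..

end

primrec ord_of_nat :: "nat \<Rightarrow> 'a ordinal" where
  "ord_of_nat 0 = 0"
| "ord_of_nat (Suc n) = ord_succ (ord_of_nat n)"

definition ord_omega :: "'a ordinal" where
  "ord_omega = Sup (range ord_of_nat)"

function omega_pow :: "'a ordinal \<Rightarrow> 'a ordinal" where
  "omega_pow a = Sup (insert 1 ((\<lambda>b. omega_pow b * ord_omega) ` {..<a}))"
  by auto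
termination
  by (relation "{(x, y). x < y}") (simp_all add: wellorder_class.wf)

declare omega_pow.simps [simp del]

definition ord_limit :: "'a ordinal \<Rightarrow> bool" where
  "ord_limit a \<longleftrightarrow> a \<noteq> 0 \<and> (\<forall>b. a \<noteq> ord_succ b)"

lemma ordinal_zero_le [simp]: "0 \<le> a" for a :: "'a ordinal"
  by (simp add: zero_ordinal_def Least_le)

lemma ordinal_lessThan_zero [simp]: "{..<0 :: 'a ordinal} = {}"
  using leD[OF ordinal_zero_le] by blast

lemma ord_succ_less [simp]: "a < ord_succ a"
  unfolding ord_succ_def using ordinal_no_top by (rule LeastI_ex)

lemma ord_succ_le_iff: "ord_succ a \<le> b \<longleftrightarrow> a < b"
  using ord_succ_less[of a] unfolding ord_succ_def by (metis Least_le order_less_le_trans)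

lemma less_ord_succ_iff: "a < ord_succ b \<longleftrightarrow> a \<le> b"
  by (metis ord_succ_le_iff not_less)

lemma lessThan_ord_succ: "{..<ord_succ a} = insert a {..<a}"
  by (auto simp: less_ord_succ_iff)

lemma ord_limit_succ_less: "ord_limit a \<Longrightarrow> b < a \<Longrightarrow> ord_succ b < a"
  by (metis ord_limit_def ord_succ_le_iff order_le_less)

lemma Sup_ordinal_empty [simp]: "Sup {} = (0 :: 'a ordinal)"
  by (simp add: Sup_ordinal_def zero_ordinal_def)

lemma ordinal_add_0: "a + 0 = a" for a :: "'a ordinal"
  by (simp add: plus_ordinal.simps[of a 0])

lemma ordinal_add_less:
  fixes a b c :: "'a ordinal"
  assumes "b < c"
  shows "a + b < a + c"
proof -
  have "ord_succ (a + b) \<le> a + c"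
    unfolding plus_ordinal.simps[of a c] using assms by (intro cSup_upper) auto
  then show ?thesis by (simp only: ord_succ_le_iff)
qed

lemma ordinal_add_succ: "a + ord_succ b = ord_succ (a + b)"
proof (rule antisym)
  have *: "a + c \<le> a + b" if "c \<le> b" for c
    using that ordinal_add_less[of c b a] by (auto simp: order_le_less)
  have "a \<le> a + b" using *[of 0] by (simp add: ordinal_add_0)
  then have "a \<le> ord_succ (a + b)" by (meson ord_succ_less less_imp_le order_trans)
  then show "a + ord_succ b \<le> ord_succ (a + b)"
    unfolding plus_ordinal.simps[of a "ord_succ b"]
    using * by (intro cSup_least) (auto simp: less_ord_succ_iff ord_succ_le_iff)
  show "ord_succ (a + b) \<le> a + ord_succ b"
    by (simp add: ord_succ_le_iff ordinal_add_less)
qed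

lemma ordinal_add_limit: "ord_limit l \<Longrightarrow> a + l = Sup ((\<lambda>b. a + b) ` {..<l})"
proof (rule antisym)
  assume l: "ord_limit l"
  then have pos: "0 < l" by (simp add: ord_limit_def order_less_le)
  show "Sup ((\<lambda>b. a + b) ` {..<l}) \<le> a + l"
    using pos by (intro cSup_least) (auto intro: less_imp_le ordinal_add_less)
  have "a + b \<le> Sup ((\<lambda>b. a + b) ` {..<l})" if "b < l" for b
    using that by (intro cSup_upper) auto
  note * = this this[OF ord_limit_succ_less[OF l]]
  show "a + l \<le> Sup ((\<lambda>b. a + b) ` {..<l})"
    unfolding plus_ordinal.simps[of a l]
    using *(1)[OF pos] *(2) by (intro cSup_least) (auto simp: ordinal_add_0 ordinal_add_succ)
qed

lemma ordinal_add_le: "a \<le> a + b" for a b :: "'a ordinal"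
  using ordinal_add_less[of 0 b a] by (cases "b = 0") (auto simp: ordinal_add_0 order_less_le)

lemma ordinal_mult_0: "a * 0 = 0" for a :: "'a ordinal"
  by (simp add: times_ordinal.simps[of a 0])

lemma ordinal_mult_le: "b < c \<Longrightarrow> a * b + a \<le> a * c" for a b c :: "'a ordinal"
  unfolding times_ordinal.simps[of a c] by (rule cSup_upper) auto

lemma ordinal_mult_mono: "b \<le> c \<Longrightarrow> a * b \<le> a * c" for a b c :: "'a ordinal"
  using ordinal_mult_le[of b c a] ordinal_add_le[of "a * b" a] by (auto simp: order_le_less)

lemma ordinal_mult_succ: "a * ord_succ b = a * b + a"
proof (rule antisym)
  show "a * b + a \<le> a * ord_succ b" by (simp add: ordinal_mult_le)
  have "a * c + a \<le> a * b + a" if "c \<le> b" for c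
    using that ordinal_mult_le[of c b a] ordinal_add_le[of "a * b" a] by (auto simp: order_le_less)
  then show "a * ord_succ b \<le> a * b + a"
    unfolding times_ordinal.simps[of a "ord_succ b"]
    by (intro cSup_least) (auto simp: less_ord_succ_iff lessThan_ord_succ)
qed

lemma ordinal_mult_limit: "ord_limit l \<Longrightarrow> a * l = Sup ((\<lambda>b. a * b) ` {..<l})"
proof (rule antisym)
  assume l: "ord_limit l"
  then have pos: "0 < l" by (simp add: ord_limit_def order_less_le)
  show "Sup ((\<lambda>b. a * b) ` {..<l}) \<le> a * l"
    using pos by (intro cSup_least) (auto intro: less_imp_le ordinal_mult_mono)
  have "a * b \<le> Sup ((\<lambda>b. a * b) ` {..<l})" if "b < l" for b
    using that by (intro cSup_upper) auto
  note * = this[OF ord_limit_succ_less[OF l]]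
  show "a * l \<le> Sup ((\<lambda>b. a * b) ` {..<l})"
    unfolding times_ordinal.simps[of a l]
    using pos * by (intro cSup_least) (auto simp: ordinal_mult_succ)
qed

lemma ordinal_add_mono:
  fixes a b c d :: "'a ordinal"
  assumes "a \<le> b" "c \<le> d"
  shows "a + c \<le> b + d"
proof -
  have "a + c \<le> b + c"
  proof (induction c rule: less_induct)
    case (less c)
    have "ord_succ (a + e) \<le> b + c" if "e < c" for e
      using less[OF that] ordinal_add_less[OF that, of b]
      by (auto simp: ord_succ_le_iff intro: le_less_trans)
    moreover have "a \<le> b + c"
      using assms(1) ordinal_add_le by (rule order_trans)
    ultimately show ?case
      unfolding plus_ordinal.simps[of a c] by (intro cSup_least) auto
  qed
  also have "b + c \<le> b + d"
    using assms(2) ordinal_add_less[of c d b] by (auto simp: order_le_less)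
  finally show ?thesis .
qed

lemma ordinal_mult_mono_left: "a \<le> b \<Longrightarrow> a * c \<le> b * c" for a b c :: "'a ordinal"
proof (induction c rule: less_induct)
  case (less c)
  have "a * e + a \<le> b * c" if "e < c" for e
    using ordinal_add_mono[OF less.IH[OF that less.prems] less.prems] ordinal_mult_le[OF that, of b]
    by (rule order_trans)
  then show ?case
    unfolding times_ordinal.simps[of a c]
    by (cases "{..<c} = {}") (auto intro!: cSup_least)
qed

lemma ordinal_zero_add: "0 + b = b" for b :: "'a ordinal"
proof (induction b rule: less_induct)
  case (less b)
  have "b \<le> c" if "\<forall>e<b. ord_succ e \<le> c" for c
    using that by (metis ord_succ_le_iff not_less less_irrefl)
  moreover have "\<forall>e<b. ord_succ e \<le> Sup (insert 0 (ord_succ ` {..<b}))"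
    by (intro allI impI cSup_upper) auto
  ultimately have "b \<le> Sup (insert 0 (ord_succ ` {..<b}))" .
  moreover have "Sup (insert 0 (ord_succ ` {..<b})) \<le> b"
    by (intro cSup_least) (auto simp: ord_succ_le_iff)
  ultimately have "Sup (insert 0 (ord_succ ` {..<b})) = b"
    by (rule antisym[rotated])
  moreover have "(\<lambda>c. ord_succ (0 + c)) ` {..<b} = ord_succ ` {..<b}"
    using less by (intro image_cong) auto
  ultimately show ?case by (simp add: plus_ordinal.simps[of 0 b])
qed

lemma bdd_above_range_ord_of_nat: "bdd_above (range (ord_of_nat :: nat \<Rightarrow> 'a ordinal))"
proof (rule ordinal_small_bdd_above)
  show "range ord_of_nat \<subseteq> range (\<lambda>x :: 'a + nat. case x of Inl y \<Rightarrow> 0 :: 'a ordinal | Inr n \<Rightarrow> ord_of_nat n)"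
    (is "_ \<subseteq> range ?f")
  proof
    fix y :: "'a ordinal" assume "y \<in> range ord_of_nat"
    then obtain n where "y = ?f (Inr n)" by auto
    then show "y \<in> range ?f" by (rule range_eqI)
  qed
qed

lemma ord_of_nat_le_omega: "ord_of_nat n \<le> ord_omega"
  unfolding ord_omega_def by (intro cSup_upper bdd_above_range_ord_of_nat) simp

lemma omega_pow_0: "omega_pow 0 = 1"
  by (simp add: omega_pow.simps[of 0])

lemma omega_pow_le: "a < b \<Longrightarrow> omega_pow a * ord_omega \<le> omega_pow b"
  unfolding omega_pow.simps[of b] by (rule cSup_upper) auto

lemma omega_pow_mono: "a \<le> b \<Longrightarrow> omega_pow a \<le> omega_pow b"
  unfolding omega_pow.simps[of a] omega_pow.simps[of b] by (intro cSup_subset_mono) auto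

lemma omega_pow_le_times_omega: "omega_pow a \<le> omega_pow a * ord_omega"
proof -
  have "omega_pow a = omega_pow a * ord_of_nat 1"
    by (simp add: ordinal_mult_succ ordinal_mult_0 ordinal_zero_add)
  also have "\<dots> \<le> omega_pow a * ord_omega"
    by (intro ordinal_mult_mono ord_of_nat_le_omega)
  finally show ?thesis .
qed

lemma one_le_omega_pow: "1 \<le> omega_pow a"
  unfolding omega_pow.simps[of a] by (rule cSup_upper) auto

lemma omega_pow_succ: "omega_pow (ord_succ a) = omega_pow a * ord_omega"
proof (rule antisym)
  show "omega_pow a * ord_omega \<le> omega_pow (ord_succ a)"
    by (simp add: omega_pow_le)
  have "1 \<le> omega_pow a * ord_omega"
    using one_le_omega_pow omega_pow_le_times_omega by (rule order_trans)
  then show "omega_pow (ord_succ a) \<le> omega_pow a * ord_omega"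
    unfolding omega_pow.simps[of "ord_succ a"]
    by (intro cSup_least)
      (auto simp: less_ord_succ_iff ordinal_mult_mono_left omega_pow_mono)
qed

lemma omega_pow_limit: "ord_limit l \<Longrightarrow> omega_pow l = Sup (omega_pow ` {..<l})"
proof (rule antisym)
  assume l: "ord_limit l"
  then have pos: "0 < l" by (simp add: ord_limit_def order_less_le)
  show "Sup (omega_pow ` {..<l}) \<le> omega_pow l"
    using pos by (intro cSup_least) (auto intro: less_imp_le omega_pow_mono)
  have *: "omega_pow b \<le> Sup (omega_pow ` {..<l})" if "b < l" for b
    using that by (intro cSup_upper) auto
  show "omega_pow l \<le> Sup (omega_pow ` {..<l})"
    unfolding omega_pow.simps[of l]
    using *[OF pos] *[OF ord_limit_succ_less[OF l]]
    by (intro cSup_least) (auto simp: omega_pow_0 omega_pow_succ)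
qed

subsection \<open>Cantor normal form and nim-sum\<close>

text \<open>
  For a finitely supported \<open>f\<close>, the sum of \<open>omega_pow \<gamma> * f \<gamma>\<close> over the support of \<open>f\<close>,
  largest exponent first.
\<close>
definition cantor_sum :: "('a ordinal \<Rightarrow> nat) \<Rightarrow> 'a ordinal" where
  "cantor_sum f =
    foldr (\<lambda>\<gamma> s. omega_pow \<gamma> * ord_of_nat (f \<gamma>) + s)
      (rev (sorted_list_of_set {\<gamma>. f \<gamma> \<noteq> 0})) 0"

definition cantor_coeff :: "'a ordinal \<Rightarrow> 'a ordinal \<Rightarrow> nat" where
  "cantor_coeff \<alpha> = (THE f. finite {\<gamma>. f \<gamma> \<noteq> 0} \<and> cantor_sum f = \<alpha>)"

definition nim_sum_nat :: "('b \<Rightarrow> nat) \<Rightarrow> 'b set \<Rightarrow> nat" where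
  "nim_sum_nat = comm_monoid_set.F xor 0"

lemma comm_monoid_set_xor_nat: "comm_monoid_set xor (0 :: nat)"
  by unfold_locales

definition nim_sum :: "'a ordinal list \<Rightarrow> 'a ordinal" where
  "nim_sum \<alpha>s = cantor_sum (\<lambda>\<gamma>. nim_sum_nat (\<lambda>i. cantor_coeff (\<alpha>s ! i) \<gamma>) {..<length \<alpha>s})"

subsection \<open>The Welter function\<close>

definition mating :: "nat \<Rightarrow> nat \<Rightarrow> nat" where
  "mating x y = 2 ^ ((THE r. [x = y] (mod 2 ^ r) \<and> \<not> [x = y] (mod 2 ^ (r + 1))) + 1) - 1"

text \<open>As \<open>mating\<close> is symmetric, each two-element subset is represented by its increasing pair.\<close>
definition welter_nat :: "nat set \<Rightarrow> nat" where
  "welter_nat A = xor (nim_sum_nat (\<lambda>a. a) A)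
    (nim_sum_nat (\<lambda>(a, b). mating a b) {(a, b). a \<in> A \<and> b \<in> A \<and> a < b})"

text \<open>\<open>\<alpha> = ord_omega * omega_quot \<alpha> + ord_of_nat (omega_rem \<alpha>)\<close>\<close>
definition omega_quot :: "'a ordinal \<Rightarrow> 'a ordinal" where
  "omega_quot \<alpha> = (THE l. \<exists>m. \<alpha> = ord_omega * l + ord_of_nat m)"

definition omega_rem :: "'a ordinal \<Rightarrow> nat" where
  "omega_rem \<alpha> = (THE m. \<exists>l. \<alpha> = ord_omega * l + ord_of_nat m)"

definition welter_section :: "'a ordinal list \<Rightarrow> 'a ordinal \<Rightarrow> nat set" where
  "welter_section \<alpha>s l = {omega_rem \<alpha> |\<alpha>. \<alpha> \<in> set \<alpha>s \<and> omega_quot \<alpha> = l}"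

definition welter :: "'a ordinal list \<Rightarrow> 'a ordinal" where
  "welter \<alpha>s = ord_omega * nim_sum (map omega_quot \<alpha>s)
    + ord_of_nat (nim_sum_nat (\<lambda>l. welter_nat (welter_section \<alpha>s l)) {l. welter_section \<alpha>s l \<noteq> {}})"

subsection \<open>The game\<close>

definition welter_position :: "'a ordinal list \<Rightarrow> bool" where
  "welter_position \<alpha>s \<longleftrightarrow> distinct \<alpha>s"

definition legal_move :: "'a ordinal list \<Rightarrow> 'a ordinal list \<Rightarrow> bool" where
  "legal_move \<alpha>s \<beta>s \<longleftrightarrow>
    (\<exists>i < length \<alpha>s. \<exists>\<beta> < \<alpha>s ! i. \<beta> \<notin> set \<alpha>s \<and> \<beta>s = \<alpha>s[i := \<beta>])"

lemma welter_position_legal_move: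
  "welter_position \<alpha>s \<Longrightarrow> legal_move \<alpha>s \<beta>s \<Longrightarrow> welter_position \<beta>s"
  by (auto simp: welter_position_def legal_move_def intro: distinct_list_update)

lemma legal_move_lex:
  assumes "legal_move \<alpha>s \<beta>s"
  shows "(\<beta>s, \<alpha>s) \<in> lex {(x, y). x < y}"
proof -
  obtain i b where i: "i < length \<alpha>s" "b < \<alpha>s ! i" "\<beta>s = \<alpha>s[i := b]"
    using assms by (auto simp: legal_move_def)
  have "\<alpha>s = take i \<alpha>s @ \<alpha>s ! i # drop (Suc i) \<alpha>s"
    using i(1) by (rule id_take_nth_drop)
  moreover have "\<beta>s = take i \<alpha>s @ b # drop (Suc i) \<alpha>s"
    using i by (simp add: upd_conv_take_nth_drop)
  ultimately show ?thesis
    using i by (subst lex_conv) fastforce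
qed

text \<open>
  The options of a position are at most \<open>|'a + nat|\<close> many, so they never exhaust the type
  and the least excluded value exists.
\<close>
definition mex :: "'b :: wellorder set \<Rightarrow> 'b" where
  "mex T = (LEAST x. x \<notin> T)"

function grundy :: "'a ordinal list \<Rightarrow> 'a ordinal" where
  "grundy \<alpha>s = (if \<nexists>\<beta>s. legal_move \<alpha>s \<beta>s then 0 else mex (grundy ` {\<beta>s. legal_move \<alpha>s \<beta>s}))"
  by auto
termination
proof (relation "lex {(x, y). x < y}")
  show "wf (lex {(x, y :: 'a ordinal). x < y})"
    by (intro wf_lex wellorder_class.wf)
qed (simp add: legal_move_lex)

declare grundy.simps [simp del]

end

theory Submission
  imports Defs
begin

text \<open>
  By induction on the game it suffices that the Welter function has the two properties that
  characterise Grundy values: a legal move always changes it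
  (\<open>welter_legal_move_neq\<close>), and every smaller ordinal is the value of some option
  (\<open>welter_move\<close>).

  Write each square as \<open>\<omega> \<cdot> \<lambda> + m\<close>, so that the ordinals are lexicographically ordered pairs
  \<open>(\<lambda>, m)\<close>. A move that changes \<open>\<lambda>\<close> changes the nim-sum of the quotients; a move that keeps
  \<open>\<lambda>\<close> changes one element of one section \<open>S\<^sub>\<lambda>\<close>, and Welter's function on finite sets is
  injective in each argument. Conversely let \<open>\<omega> \<cdot> \<mu> + v\<close> be below the value of the position. If
  \<open>\<mu>\<close> is below the nim-sum of the quotients, a transfinite Nim move on the quotients reaches
  \<open>\<mu>\<close>; the coin then lands in a lower section, where its remainder may be chosen freely, and
  since Welter's function is surjective in each argument, it can be chosen so that the finite part
  is \<open>v\<close>. Otherwise \<open>\<mu>\<close> is that nim-sum and \<open>v\<close> is below the finite part; the finite part is a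
  Nim position whose heaps are the values \<open>[S\<^sub>\<lambda>]\<close>, so some \<open>[S\<^sub>\<lambda>]\<close> has to be lowered to a
  prescribed value, and Welter's theorem for the finite game provides the move.

  The facts about finite sets needed here are \<open>welter_nat_insert_inj\<close>,
  \<open>welter_nat_insert_surj\<close> and \<open>welter_nat_move\<close>. They rest on one recursion. Split
  \<open>S\<close> by parity into \<open>2 \<cdot> A \<union> (2 \<cdot> B + 1)\<close>. The mating of \<open>2 x + e\<close> and
  \<open>2 y + e\<close> is \<open>2 (x | y) + 1\<close>, and numbers of different parity have mating \<open>1\<close>, so \<open>[S] div 2 = [A] \<oplus> [B]\<close>, while the last bit
  of \<open>[S]\<close> only depends on the sizes of \<open>B\<close> and \<open>S\<close>. Injectivity and surjectivity follow bit by
  bit. For Welter's theorem, a target value with the same last bit as \<open>[S]\<close> is reached by a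
  move inside \<open>A\<close> or inside \<open>B\<close>, by induction and Nim. A target with the other last bit
  needs a coin that changes parity, that is, one that crosses between \<open>A\<close> and \<open>B\<close>; that such a
  crossing exists is again proved by splitting \<open>A\<close> and \<open>B\<close> by parity (\<open>crossing_exists\<close>).

  On the ordinal side, the proof uses division with remainder, existence of the Cantor normal
  form, and the fact that Cantor normal forms compare at the largest exponent where they differ. The
  last point makes the winning strategy of Nim work for ordinals.
\<close>

unbundle bit_operations_syntax

section \<open>Nim-sums of natural numbers\<close>

text \<open>
  The rewrite makes the library's facts about commutative finite sums apply to \<open>nim_sum_nat\<close>.
\<close>
interpretation nim: comm_monoid_set xor "0 :: nat"
  rewrites "comm_monoid_set.F xor (0 :: nat) = nim_sum_nat"
  by (fact comm_monoid_set_xor_nat) (simp add: nim_sum_nat_def)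

lemma xor_cancel [simp]: "a XOR (a XOR b) = (b :: nat)"
  by (simp flip: xor.assoc)

lemmas xor_ac = xor.assoc xor.commute xor.left_commute

lemma xor_div_2: "(a XOR b) div 2 = (a div 2) XOR (b div 2 :: nat)"
  using drop_bit_xor[of 1 a b] by (simp add: drop_bit_eq_div)

lemma odd_xor: "odd (a XOR b :: nat) \<longleftrightarrow> odd a \<noteq> odd b"
  by (simp add: even_xor_iff)

lemma nat_eq_halves: "a = (b :: nat)" if "a div 2 = b div 2" "odd a = odd b"
  using that by (metis div_mult_mod_eq odd_iff_mod_2_eq_one even_iff_mod_2_eq_zero)

lemma nat_less_halves:
  "a < (b :: nat) \<longleftrightarrow> a div 2 < b div 2 \<or> a div 2 = b div 2 \<and> even a \<and> odd b"
  by presburger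

text \<open>
  Nim with two heaps: to reach nim-sum \<open>v\<close>, heap \<open>a\<close> has to become \<open>v \<oplus> b\<close> or heap \<open>b\<close> has to become
  \<open>v \<oplus> a\<close>, and one of these is a decrease. The recursion is on binary digits. If \<open>v\<close> and
  \<open>a \<oplus> b\<close> only differ in the last digit, exactly one heap is odd, and it can be reduced by one.
\<close>
lemma xor_lessE:
  fixes a b v :: nat
  assumes "v < a XOR b"
  obtains "v XOR b < a" | "v XOR a < b"
proof -
  have "v XOR b < a \<or> v XOR a < b"
    using assms
  proof (induction "a + b" arbitrary: a b v rule: less_induct)
    case less
    then have "a + b \<noteq> 0" by (auto intro: ccontr)
    then have "a div 2 + b div 2 < a + b" by linarith
    note IH = less.hyps[OF this, of "v div 2"]
    from less.prems consider "v div 2 < (a div 2) XOR (b div 2)"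
      | "v div 2 = (a div 2) XOR (b div 2)" "even v" "odd a \<noteq> odd b"
      unfolding nat_less_halves[of v] xor_div_2 odd_xor by blast
    then show ?case
    proof cases
      case 1
      from IH[OF this] show ?thesis
        by (auto simp only: nat_less_halves[of "v XOR _"] xor_div_2)
    next
      case 2
      have "(v XOR b) div 2 = a div 2" "(v XOR a) div 2 = b div 2"
        using 2(1) by (simp_all add: xor_div_2 xor_ac)
      moreover have "even (v XOR b) \<and> odd a \<or> even (v XOR a) \<and> odd b"
        using 2(2,3) by (auto simp: even_xor_iff)
      ultimately show ?thesis
        using nat_less_halves by blast
    qed
  qed
  then show thesis using that by blast
qed

text \<open>
  Bouton's strategy: changing heap \<open>i\<close> by \<open>v \<oplus> \<Sum>\<^sup>\<oplus> f\<close> turns the nim-sum into \<open>v\<close>, and for some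
  \<open>i\<close> this change is a decrease.
\<close>
lemma nim_sum_nat_lessE:
  assumes "finite I" "v < nim_sum_nat f I"
  obtains i where "i \<in> I" "f i XOR (v XOR nim_sum_nat f I) < f i"
proof -
  have "\<exists>i\<in>I. f i XOR (v XOR nim_sum_nat f I) < f i"
    using assms
  proof (induction I arbitrary: v rule: finite_induct)
    case (insert x I)
    then have "v < f x XOR nim_sum_nat f I" by simp
    then show ?case
    proof (cases rule: xor_lessE)
      case 2
      from insert.IH[OF this] show ?thesis using insert.hyps by (auto simp: xor_ac)
    qed (use insert.hyps in \<open>auto simp: xor_ac\<close>)
  qed simp
  then show thesis using that by blast
qed

lemma nim_sum_nat_div_2: "nim_sum_nat f I div 2 = nim_sum_nat (\<lambda>i. f i div 2) I"
  by (induction I rule: infinite_finite_induct) (simp_all add: xor_div_2)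

lemma odd_nim_sum_nat:
  "(\<And>i. i \<in> I \<Longrightarrow> odd (f i)) \<Longrightarrow> odd (nim_sum_nat f I) \<longleftrightarrow> odd (card I)"
  by (induction I rule: infinite_finite_induct) (simp_all add: odd_xor)

section \<open>The mating function\<close>

lemma mating_eqI:
  assumes "[x = y] (mod 2 ^ r)" "\<not> [x = y] (mod 2 ^ (r + 1))"
  shows "mating x y = 2 ^ (r + 1) - 1"
proof -
  have unique: "s = r" if "[x = y] (mod 2 ^ s)" "\<not> [x = y] (mod 2 ^ (s + 1))" for s
  proof (rule ccontr)
    assume "s \<noteq> r"
    then consider "s + 1 \<le> r" | "r + 1 \<le> s" by linarith
    then show False using that assms by cases (meson cong_dvd_modulus_nat le_imp_power_dvd)+
  qed
  then have "(THE r. [x = y] (mod 2 ^ r) \<and> \<not> [x = y] (mod 2 ^ (r + 1))) = r"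
    using assms unique by (intro the_equality) blast+
  then show ?thesis by (simp add: mating_def)
qed

text \<open>
  Distinct numbers are incongruent modulo some power of two; the
  exponent is the one just before the first such power.
\<close>
lemma mating_exponent:
  fixes x y :: nat
  assumes "x \<noteq> y"
  obtains r where "[x = y] (mod 2 ^ r)" "\<not> [x = y] (mod 2 ^ (r + 1))"
proof -
  define n where "n = (LEAST n. \<not> [x = y] (mod 2 ^ n))"
  have "x < 2 ^ (x + y)" "y < 2 ^ (x + y)"
    by (rule le_less_trans[OF _ less_exp]; simp)+
  then have "\<not> [x = y] (mod 2 ^ (x + y))"
    using assms by (simp add: cong_def)
  then have n: "\<not> [x = y] (mod 2 ^ n)" unfolding n_def by (rule LeastI)
  then have "n \<noteq> 0" by (auto intro: ccontr)
  then obtain r where r: "n = r + 1" by (metis add.commute not0_implies_Suc plus_1_eq_Suc)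
  then have "[x = y] (mod 2 ^ r)"
    using not_less_Least[of r "\<lambda>n. \<not> [x = y] (mod 2 ^ n)"] unfolding n_def by simp
  with n r that show thesis by blast
qed

lemma mating_commute: "mating x y = mating y x"
  unfolding mating_def by (simp add: cong_sym_eq)

lemma mating_parity: "odd x \<noteq> odd y \<Longrightarrow> mating x y = 1"
  using mating_eqI[of x y 0] by (auto simp: cong_def) presburger+

lemma mating_double:
  assumes "x \<noteq> y"
  shows "mating (2 * x) (2 * y) = 2 * mating x y + 1"
    and "mating (Suc (2 * x)) (Suc (2 * y)) = 2 * mating x y + 1"
proof -
  obtain r where r: "[x = y] (mod 2 ^ r)" "\<not> [x = y] (mod 2 ^ (r + 1))"
    using assms by (rule mating_exponent)
  have *: "[2 * x = 2 * y] (mod 2 ^ Suc s) \<longleftrightarrow> [x = y] (mod 2 ^ s)" for s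
    by (simp add: cong_def)
  have **: "[Suc (2 * x) = Suc (2 * y)] (mod 2 ^ Suc s) \<longleftrightarrow> [x = y] (mod 2 ^ s)" for s
    using cong_add_rcancel_nat[of "2 * x" 1 "2 * y"] * by simp
  have "(2 :: nat) ^ (Suc r + 1) - 1 = 2 * (2 ^ (r + 1) - 1) + 1"
    using one_le_power[of "2 :: nat" r] by (simp only: power_add power_Suc power_one_right) linarith
  moreover have "[x = y] (mod 2 ^ r)" "\<not> [x = y] (mod 2 ^ Suc r)" using r by simp_all
  ultimately show "mating (2 * x) (2 * y) = 2 * mating x y + 1"
    "mating (Suc (2 * x)) (Suc (2 * y)) = 2 * mating x y + 1"
    using mating_eqI[OF r] mating_eqI[of "2 * x" "2 * y" "Suc r"]
      mating_eqI[of "Suc (2 * x)" "Suc (2 * y)" "Suc r"]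
    by (simp_all only: * ** Suc_eq_plus1[symmetric] not_False_eq_True)
qed

lemma odd_mating:
  assumes "x \<noteq> y"
  shows "odd (mating x y)"
proof -
  obtain r where "[x = y] (mod 2 ^ r)" "\<not> [x = y] (mod 2 ^ (r + 1))"
    using assms by (rule mating_exponent)
  then have "mating x y = 2 ^ (r + 1) - 1" by (rule mating_eqI)
  then show ?thesis by simp
qed

section \<open>Welter's function and binary digits\<close>

lemma welter_nat_empty [simp]: "welter_nat {} = 0"
  by (simp add: welter_nat_def)

text \<open>
  The pairs of \<open>insert a S\<close> that are not pairs of \<open>S\<close> are the sorted pairs of \<open>a\<close> with the elements
  of \<open>S\<close>; symmetry of the mating function makes the sorting irrelevant.
\<close>
lemma welter_nat_insert:
  assumes "finite S" "a \<notin> S"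
  shows "welter_nat (insert a S) = welter_nat S XOR (a XOR nim_sum_nat (mating a) S)"
proof -
  define pairs :: "nat set \<Rightarrow> (nat \<times> nat) set"
    where "pairs T = {(x, y). x \<in> T \<and> y \<in> T \<and> x < y}" for T
  define q where "q b = (if a < b then (a, b) else (b, a))" for b
  have neq: "b < a \<longleftrightarrow> \<not> a < b" if "b \<in> S" for b
    using assms(2) that by (metis linorder_cases less_asym)
  have fin: "finite (pairs T)" if "finite T" for T
    using that by (intro finite_subset[of "pairs T" "T \<times> T"]) (auto simp: pairs_def)
  have "pairs (insert a S) = pairs S \<union> q ` S"
    using neq by (force simp: pairs_def q_def split: if_splits)
  moreover have "pairs S \<inter> q ` S = {}"
    using assms(2) by (auto simp: pairs_def q_def split: if_splits)
  moreover have "inj_on q S"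
    using assms(2) by (auto simp: q_def inj_on_def split: if_splits)
  moreover have "(\<lambda>(x, y). mating x y) (q b) = mating a b" for b
    by (simp add: q_def mating_commute)
  ultimately have "nim_sum_nat (\<lambda>(x, y). mating x y) (pairs (insert a S))
      = nim_sum_nat (\<lambda>(x, y). mating x y) (pairs S) XOR nim_sum_nat (mating a) S"
    using assms(1) fin by (simp add: nim.union_disjoint nim.reindex o_def)
  then show ?thesis
    using assms by (simp add: welter_nat_def pairs_def xor_ac)
qed

text \<open>
  Besides \<open>a\<close> itself, the value acquires \<open>card S\<close> matings, and all matings are odd.
\<close>
lemma odd_welter_nat_insert:
  assumes "finite S" "a \<notin> S"
  shows "odd (welter_nat (insert a S)) \<longleftrightarrow> odd (welter_nat S) \<noteq> odd (a + card S)"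
proof -
  have "odd (nim_sum_nat (mating a) S) \<longleftrightarrow> odd (card S)"
    using assms(2) by (intro odd_nim_sum_nat odd_mating) auto
  then show ?thesis using assms by (auto simp: welter_nat_insert odd_xor)
qed

text \<open>
  The elements with last binary digit \<open>e \<in> {0, 1}\<close>, with that digit dropped. A numerical \<open>e\<close> makes
  \<open>2 * x + e\<close> a uniform name for the elements, and \<open>half (1 - e) S\<close> is the other part.
\<close>
definition half :: "nat \<Rightarrow> nat set \<Rightarrow> nat set" where
  "half e S = (\<lambda>x. 2 * x + e) -` S"

lemma mem_half [simp]: "x \<in> half e S \<longleftrightarrow> 2 * x + e \<in> S"
  by (simp add: half_def)

lemma finite_half [simp, intro]: "finite S \<Longrightarrow> finite (half e S)"
  unfolding half_def by (rule finite_vimageI) (auto intro: injI)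

lemma half_empty [simp]: "half e {} = {}"
  by (simp add: half_def)

lemma half_insert:
  assumes "e \<le> 1"
  shows "half e (insert (2 * x + e) S) = insert x (half e S)"
    and "half (1 - e) (insert (2 * x + e) S) = half (1 - e) S"
  using assms by (auto simp: half_def) presburger

lemma half_remove:
  assumes "e \<le> 1"
  shows "half e (S - {2 * x + e}) = half e S - {x}"
    and "half (1 - e) (S - {2 * x + e}) = half (1 - e) S"
  using assms by (auto simp: half_def) presburger

lemma halfE:
  fixes a :: nat
  obtains x e where "a = 2 * x + e" "e \<le> 1"
proof
  show "a = 2 * (a div 2) + a mod 2" "a mod 2 \<le> 1" by simp_all
qed

lemma half_cases: "e \<le> 1 \<Longrightarrow> e = 0 \<or> e = (1 :: nat)"
  by auto

lemma card_half: "finite S \<Longrightarrow> card S = card (half 0 S) + card (half 1 S)"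
proof (induction S rule: finite_induct)
  case (insert a S)
  obtain x e where a: "a = 2 * x + e" "e \<le> 1" by (rule halfE)
  have "x \<notin> half e S" using insert.hyps a by simp
  then show ?case
    using half_cases[OF a(2)] insert half_insert[OF a(2), of x S]
    by (auto simp: a(1))
qed simp

text \<open>
  The sum of the elements is the measure of the inductions below: it drops when a set is halved, unless
  the set is contained in \<open>{0}\<close>.
\<close>
lemma sum_half: "finite S \<Longrightarrow> \<Sum>S = 2 * \<Sum>(half 0 S) + 2 * \<Sum>(half 1 S) + card (half 1 S)"
proof (induction S rule: finite_induct)
  case (insert a S)
  obtain x e where a: "a = 2 * x + e" "e \<le> 1" by (rule halfE)
  have "x \<notin> half e S" using insert.hyps a by simp
  then show ?case
    using half_cases[OF a(2)] insert half_insert[OF a(2), of x S]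
    by (auto simp: a(1))
qed simp

lemma sum_half_less:
  assumes "finite S" "e \<le> 1" "\<Sum>S \<noteq> 0"
  shows "\<Sum>(half e S) < \<Sum>S"
  using sum_half[OF assms(1)] half_cases[OF assms(2)] assms(3) by auto

text \<open>
  Matings with numbers of the other parity are \<open>1\<close> and disappear on halving, the others turn into
  the matings of the halved numbers.
\<close>
lemma mating_half:
  assumes "2 * x + e \<notin> S" "e \<le> 1" "finite S"
  shows "nim_sum_nat (\<lambda>b. mating (2 * x + e) b div 2) S = nim_sum_nat (mating x) (half e S)"
  using assms(3,1)
proof (induction S rule: finite_induct)
  case (insert b S)
  obtain y d where b: "b = 2 * y + d" "d \<le> 1" by (rule halfE)
  show ?case
  proof (cases "d = e")
    case True
    then have "x \<noteq> y" "y \<notin> half e S" using insert b by auto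
    moreover have "mating (2 * x + e) b div 2 = mating x y"
      using mating_double[OF \<open>x \<noteq> y\<close>] half_cases[OF assms(2)] b True by auto
    ultimately show ?thesis
      using insert b True by (simp add: half_insert(1)[OF assms(2)])
  next
    case False
    then have "d = 1 - e" "e = 1 - d" using b(2) assms(2) by auto
    then have "half e (insert b S) = half e S"
      using half_insert(2)[OF b(2), of y S] b(1) by simp
    moreover have "mating (2 * x + e) b = 1"
      using False half_cases[OF assms(2)] half_cases[OF b(2)]
      by (intro mating_parity) (auto simp: b(1))
    ultimately show ?thesis using insert by simp
  qed
qed simp

text \<open>
  The recursion that carries the theory of the finite game: up to the last binary digit, the value
  of a position is the nim-sum of the values of its two halves.
\<close>
lemma welter_nat_div_2:
  "finite S \<Longrightarrow> welter_nat S div 2 = welter_nat (half 0 S) XOR welter_nat (half 1 S)"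
proof (induction S rule: finite_induct)
  case (insert a S)
  obtain x e where a: "a = 2 * x + e" "e \<le> 1" by (rule halfE)
  have x: "x \<notin> half e S" using insert.hyps a by simp
  have "welter_nat (insert a S) div 2
      = welter_nat S div 2 XOR (a div 2 XOR nim_sum_nat (\<lambda>b. mating a b div 2) S)"
    using insert.hyps by (simp add: welter_nat_insert xor_div_2 nim_sum_nat_div_2)
  also have "a div 2 = x" using a by simp
  also have "nim_sum_nat (\<lambda>b. mating a b div 2) S = nim_sum_nat (mating x) (half e S)"
    using insert.hyps a by (simp add: mating_half)
  finally show ?case
    using half_cases[OF a(2)] insert x half_insert[OF a(2), of x S]
    by (auto simp: welter_nat_insert xor_ac a(1))
qed simp

lemma choose_two_Suc: "Suc n choose 2 = n + (n choose 2)"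
  by (simp add: numeral_2_eq_2)

lemma choose_two_0 [simp]: "0 choose 2 = 0"
  by (simp add: numeral_2_eq_2)

lemma even_choose_two_add:
  "even (m + n choose 2) \<longleftrightarrow>
    ((even (m choose 2) \<longleftrightarrow> even (n choose 2)) \<longleftrightarrow> even m \<or> even n)"
  by (induction m) (auto simp: choose_two_Suc)

text \<open>
  The complement to the recursion: the last binary digit counts the odd elements and the pairs.
\<close>
lemma odd_welter_nat:
  "finite S \<Longrightarrow> odd (welter_nat S) \<longleftrightarrow> odd (card (half 1 S) + (card S choose 2))"
proof (induction S rule: finite_induct)
  case (insert a S)
  obtain x e where a: "a = 2 * x + e" "e \<le> 1" by (rule halfE)
  have x: "x \<notin> half e S" using insert.hyps a by simp
  then show ?case
    using half_cases[OF a(2)] insert half_insert[OF a(2), of x S]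
      odd_welter_nat_insert[OF insert.hyps]
    by (auto simp: a(1) choose_two_Suc)
qed simp

lemma welter_nat_div_2_half:
  assumes "finite S" "e \<le> 1"
  shows "welter_nat S div 2 = welter_nat (half e S) XOR welter_nat (half (1 - e) S)"
  using welter_nat_div_2[OF assms(1)] half_cases[OF assms(2)] by (auto simp: xor_ac)

lemma welter_nat_insert_div_2:
  assumes "finite S" "e \<le> 1"
  shows "welter_nat (insert (2 * x + e) S) div 2
    = welter_nat (insert x (half e S)) XOR welter_nat (half (1 - e) S)"
  using assms half_insert[OF assms(2)] by (simp add: welter_nat_div_2_half[OF _ assms(2)])

lemma welter_nat_remove_div_2:
  assumes "finite S" "e \<le> 1"
  shows "welter_nat (S - {2 * x + e}) div 2
    = welter_nat (half e S - {x}) XOR welter_nat (half (1 - e) S)"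
  using assms half_remove[OF assms(2)] by (simp add: welter_nat_div_2_half[OF _ assms(2)])

section \<open>Welter's function is bijective in each argument\<close>

lemma sum_eq_0_subset: "finite S \<Longrightarrow> \<Sum>S = 0 \<Longrightarrow> S = {} \<or> S = {0 :: nat}"
  by auto

lemma welter_nat_singleton [simp]: "welter_nat {a} = a"
  by (simp add: welter_nat_insert)

text \<open>
  The last digit of the value determines the parity of the added number, after which the recursion
  determines the remaining digits.
\<close>
lemma welter_nat_insert_inj:
  assumes "finite S" "m \<notin> S" "n \<notin> S" "welter_nat (insert m S) = welter_nat (insert n S)"
  shows "m = n"
  using assms
proof (induction "m + n" arbitrary: m n S rule: less_induct)
  case less
  obtain x e where m: "m = 2 * x + e" "e \<le> 1" by (rule halfE)
  have "odd m \<longleftrightarrow> odd n"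
    using less.prems odd_welter_nat_insert[of S m] odd_welter_nat_insert[of S n] by auto
  then have "n mod 2 = e" using m by presburger
  then obtain y where n: "n = 2 * y + e" by (metis div_mult_mod_eq mult.commute)
  have "welter_nat (insert x (half e S)) XOR welter_nat (half (1 - e) S)
      = welter_nat (insert y (half e S)) XOR welter_nat (half (1 - e) S)"
    unfolding welter_nat_insert_div_2[OF less.prems(1) m(2), symmetric]
    using less.prems(4) m(1) n by simp
  then have "welter_nat (insert x (half e S)) = welter_nat (insert y (half e S))"
    by (metis xor_cancel xor.commute)
  moreover have "x \<notin> half e S" "y \<notin> half e S" using less.prems m n by auto
  ultimately have "x + y < m + n \<Longrightarrow> x = y" using less by blast
  then show "m = n" using m n by linarith
qed

text \<open>
  The value of \<open>{0, x}\<close>. A set contained in \<open>{0}\<close> is its own half, so this case has to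
  be treated directly.
\<close>
lemma xor_mating_0: "0 < x \<Longrightarrow> x XOR mating x 0 = x - 1"
proof (induction x rule: less_induct)
  case (less x)
  obtain k e where x: "x = 2 * k + e" "e \<le> 1" by (rule halfE)
  show ?case
  proof (cases "e = 0")
    case True
    then have "k \<noteq> 0" "mating x 0 = 2 * mating k 0 + 1"
      using x less.prems mating_double(1)[of k 0] by auto
    moreover from this have "k XOR mating k 0 = k - 1" using less.IH[of k] x by simp
    ultimately show ?thesis
      using True x by - (rule nat_eq_halves; simp add: xor_div_2 even_xor_iff)
  next
    case False
    then have "mating x 0 = 1" using x half_cases[OF x(2)] by (intro mating_parity) auto
    then show ?thesis
      using False x by - (rule nat_eq_halves; simp add: xor_div_2 even_xor_iff)
  qed
qed

text \<open>
  The wanted last digit of the value fixes the parity \<open>e\<close> of the number to be added, and halving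
  leaves the same problem for \<open>half e S\<close>.
\<close>
lemma welter_nat_insert_surj:
  assumes "finite S"
  obtains m where "m \<notin> S" "welter_nat (insert m S) = v"
proof -
  have "\<exists>m. m \<notin> S \<and> welter_nat (insert m S) = v"
    using assms
  proof (induction "\<Sum>S" arbitrary: S v rule: less_induct)
    case less
    show ?case
    proof (cases "\<Sum>S = 0")
      case True
      then consider "S = {}" | "S = {0}" using sum_eq_0_subset less.prems by blast
      then show ?thesis
      proof cases
        case 2
        have "welter_nat (insert (Suc v) {0}) = v"
          using xor_mating_0[of "Suc v"] by (subst welter_nat_insert) auto
        then show ?thesis using 2 by blast
      qed auto
    next
      case False
      define e :: nat where "e = of_bool (odd v \<noteq> odd (welter_nat S + card S))"
      have e: "e \<le> 1" "odd v \<longleftrightarrow> (odd (welter_nat S) \<noteq> odd (e + card S))"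
        by (auto simp: e_def)
      obtain x where x: "x \<notin> half e S"
        "welter_nat (insert x (half e S)) = v div 2 XOR welter_nat (half (1 - e) S)"
        using less.hyps[OF sum_half_less[OF less.prems e(1) False]] less.prems by blast
      let ?m = "2 * x + e"
      have "?m \<notin> S" using x by simp
      moreover have "welter_nat (insert ?m S) = v"
      proof (rule nat_eq_halves)
        show "welter_nat (insert ?m S) div 2 = v div 2"
          using x less.prems e(1) by (simp add: welter_nat_insert_div_2 xor.assoc)
        show "odd (welter_nat (insert ?m S)) = odd v"
          using odd_welter_nat_insert[OF less.prems \<open>?m \<notin> S\<close>] e(2) by auto
      qed
      ultimately show ?thesis by blast
    qed
  qed
  then show thesis using that by blast
qed

section \<open>Moves in the finite game\<close>

text \<open>
  Moving a coin from \<open>A\<close> to \<open>B\<close> changes the number of pairs by an amount that has the parity of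
  \<open>card A + card B + 1\<close>; with the numbers on the coin this gives the change of the last digit.
\<close>
lemma odd_welter_nat_transfer:
  assumes "finite A" "finite B" "x \<in> A" "y \<notin> B"
  shows "odd (welter_nat (A - {x}) XOR welter_nat (insert y B)) \<longleftrightarrow>
    (odd (welter_nat A XOR welter_nat B) \<noteq> odd (x + y + card A + card B + 1))"
proof -
  obtain A' where A: "A = insert x A'" "x \<notin> A'" using mk_disjoint_insert[OF assms(3)] by blast
  then show ?thesis
    using assms odd_welter_nat_insert[of A' x] odd_welter_nat_insert[of B y]
    by (auto simp: odd_xor)
qed

text \<open>
  A transfer between \<open>A\<close> and \<open>B\<close> is a transfer between two of their halves: the other two halves only
  shift the target value by a constant, and the parity condition takes care of the last digit.
\<close>
lemma welter_nat_transfer_half: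
  assumes "finite A" "finite B" "e \<le> 1" "d \<le> 1" "2 * x + e \<in> A" "2 * y + d \<notin> B"
    and parity: "odd v \<longleftrightarrow> (odd (welter_nat A XOR welter_nat B) \<noteq> odd (e + d + card A + card B + 1))"
    and v: "welter_nat (half e A - {x}) XOR welter_nat (insert y (half d B)) =
      v div 2 XOR (welter_nat (half (1 - e) A) XOR welter_nat (half (1 - d) B))"
  shows "welter_nat (A - {2 * x + e}) XOR welter_nat (insert (2 * y + d) B) = v"
    (is "?w = v")
proof (rule nat_eq_halves)
  have "?w div 2 = (welter_nat (half e A - {x}) XOR welter_nat (insert y (half d B)))
      XOR (welter_nat (half (1 - e) A) XOR welter_nat (half (1 - d) B))"
    using assms(1-4)
    by (simp only: xor_div_2 welter_nat_insert_div_2 welter_nat_remove_div_2 xor_ac)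
  also have "\<dots> = v div 2" unfolding v by (simp add: xor.assoc)
  finally show "?w div 2 = v div 2" .
  show "odd ?w = odd v"
    using odd_welter_nat_transfer[OF assms(1,2,5,6)] parity by auto
qed

text \<open>
  A coin of the position \<open>2 \<cdot> A \<union> (2 \<cdot> B + 1)\<close> changes parity, from \<open>2 x\<close> to
  \<open>2 y + 1 < 2 x\<close> or from \<open>2 y + 1\<close> to \<open>2 x < 2 y + 1\<close>, so that half the value of the new position is
  \<open>v\<close>. The strict and the weak inequality are these two conditions for the halved numbers.
\<close>
definition crossing :: "nat set \<Rightarrow> nat set \<Rightarrow> nat \<Rightarrow> bool" where
  "crossing A B v \<longleftrightarrow>
    (\<exists>x\<in>A. \<exists>y. y \<notin> B \<and> y < x \<and> welter_nat (A - {x}) XOR welter_nat (insert y B) = v) \<or>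
    (\<exists>y\<in>B. \<exists>x. x \<notin> A \<and> x \<le> y \<and> welter_nat (B - {y}) XOR welter_nat (insert x A) = v)"

text \<open>
  The order condition lifts because \<open>y < x\<close> gives \<open>2 y + d < 2 x + e\<close> for all last digits, and
  \<open>x \<le> y\<close> gives \<open>2 x + e \<le> 2 y + d\<close> for \<open>e \<le> d\<close>.
\<close>
lemma crossing_half:
  assumes "finite A" "finite B" "e \<le> d" "d \<le> 1"
    and parity: "odd v \<longleftrightarrow> (odd (welter_nat A XOR welter_nat B) \<noteq> odd (e + d + card A + card B + 1))"
    and "crossing (half e A) (half d B)
      (v div 2 XOR (welter_nat (half (1 - e) A) XOR welter_nat (half (1 - d) B)))"
  shows "crossing A B v"
proof -
  have e: "e \<le> 1" using assms by simp
  have parity': "odd v \<longleftrightarrow>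
      (odd (welter_nat B XOR welter_nat A) \<noteq> odd (d + e + card B + card A + 1))"
    using parity by (simp add: xor_ac ac_simps)
  show ?thesis
    using assms(6) unfolding crossing_def[of "half e A"]
  proof (elim disjE bexE exE conjE)
    fix x y
    assume "x \<in> half e A" "y \<notin> half d B" "y < x"
      and v: "welter_nat (half e A - {x}) XOR welter_nat (insert y (half d B)) =
        v div 2 XOR (welter_nat (half (1 - e) A) XOR welter_nat (half (1 - d) B))"
    then have *: "2 * x + e \<in> A" "2 * y + d \<notin> B" "2 * y + d < 2 * x + e"
      using assms(4) by auto
    show ?thesis
      using welter_nat_transfer_half[OF assms(1,2) e assms(4) *(1,2) parity v] *
      unfolding crossing_def by blast
  next
    fix x y
    assume "y \<in> half d B" "x \<notin> half e A" "x \<le> y"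
      and "welter_nat (half d B - {y}) XOR welter_nat (insert x (half e A)) =
        v div 2 XOR (welter_nat (half (1 - e) A) XOR welter_nat (half (1 - d) B))"
    then have *: "2 * y + d \<in> B" "2 * x + e \<notin> A" "2 * x + e \<le> 2 * y + d"
      and v: "welter_nat (half d B - {y}) XOR welter_nat (insert x (half e A)) =
        v div 2 XOR (welter_nat (half (1 - d) B) XOR welter_nat (half (1 - e) A))"
      using assms(3) by (auto simp: xor_ac)
    show ?thesis
      using welter_nat_transfer_half[OF assms(2,1,4) e *(1,2) parity' v] *
      unfolding crossing_def by blast
  qed
qed

text \<open>
  An element \<open>2 x + 1\<close> of \<open>A\<close> may become \<open>2 y\<close> in \<open>B\<close> if \<open>y \<le> x\<close>, and an element \<open>2 y\<close> of \<open>B\<close>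
  may become \<open>2 x + 1\<close> in \<open>A\<close> if \<open>x < y\<close>. The strict and the weak inequality are exchanged,
  and with them the roles of the two sets.
\<close>
lemma crossing_half_swap:
  assumes "finite A" "finite B"
    and parity: "odd v \<longleftrightarrow> (odd (welter_nat A XOR welter_nat B) \<noteq> odd (card A + card B))"
    and "crossing (half 0 B) (half 1 A)
      (v div 2 XOR (welter_nat (half 0 A) XOR welter_nat (half 1 B)))"
  shows "crossing A B v"
proof -
  have parity1: "odd v \<longleftrightarrow>
      (odd (welter_nat B XOR welter_nat A) \<noteq> odd (0 + 1 + card B + card A + 1))"
    and parity2: "odd v \<longleftrightarrow>
      (odd (welter_nat A XOR welter_nat B) \<noteq> odd (1 + 0 + card A + card B + 1))"
    using parity by (auto simp: xor_ac)
  show ?thesis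
    using assms(4) unfolding crossing_def[of "half 0 B"]
  proof (elim disjE bexE exE conjE)
    fix x y
    assume "x \<in> half 0 B" "y \<notin> half 1 A" "y < x"
      and "welter_nat (half 0 B - {x}) XOR welter_nat (insert y (half 1 A)) =
        v div 2 XOR (welter_nat (half 0 A) XOR welter_nat (half 1 B))"
    then have *: "2 * x + 0 \<in> B" "2 * y + 1 \<notin> A" "2 * y + 1 \<le> 2 * x + 0"
      and v: "welter_nat (half 0 B - {x}) XOR welter_nat (insert y (half 1 A)) =
        v div 2 XOR (welter_nat (half (1 - 0) B) XOR welter_nat (half (1 - 1) A))"
      by (auto simp: xor_ac)
    show ?thesis
      using welter_nat_transfer_half[OF assms(2,1) _ _ *(1,2) parity1 v] *
      unfolding crossing_def by force
  next
    fix x y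
    assume "y \<in> half 1 A" "x \<notin> half 0 B" "x \<le> y"
      and "welter_nat (half 1 A - {y}) XOR welter_nat (insert x (half 0 B)) =
        v div 2 XOR (welter_nat (half 0 A) XOR welter_nat (half 1 B))"
    then have *: "2 * y + 1 \<in> A" "2 * x + 0 \<notin> B" "2 * x + 0 < 2 * y + 1"
      and v: "welter_nat (half 1 A - {y}) XOR welter_nat (insert x (half 0 B)) =
        v div 2 XOR (welter_nat (half (1 - 1) A) XOR welter_nat (half (1 - 0) B))"
      by auto
    show ?thesis
      using welter_nat_transfer_half[OF assms(1,2) _ _ *(1,2) parity2 v] *
      unfolding crossing_def by force
  qed
qed

text \<open>
  Let \<open>S = 2 \<cdot> A \<union> (2 \<cdot> B + 1)\<close>. By \<open>odd_welter_nat\<close> the hypothesis says that the number with half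
  \<open>v\<close> and last digit different from that of \<open>[S]\<close> is smaller than \<open>[S]\<close>, so that some option of \<open>S\<close>
  has to have this value.

  Whether a transferred coin keeps its parity is dictated by the last digit of \<open>v\<close>, by
  \<open>odd_welter_nat_transfer\<close>. Hence the transfers are those between two pairs of halves: halves of equal
  parity in the one case, of opposite parity in the other. If \<open>v div 2\<close> is below the halved value of
  \<open>(A, B)\<close>, Nim strategy lowers the value of one pair and the induction hypothesis applies to it. If the
  two are equal, each pair has to keep its value. In this case expansion of the binomial coefficients shows
  that the numbers \<open>|B| + (|A| + |B| choose 2)\<close> of the two pairs have an odd sum; so one of them is odd and
  the induction hypothesis applies to that pair.
\<close>
lemma crossing_exists:
  assumes "finite A" "finite B"
    and "v < welter_nat A XOR welter_nat B \<or>
      v = welter_nat A XOR welter_nat B \<and> odd (card B + (card A + card B choose 2))"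
  shows "crossing A B v"
  using assms
proof (induction "\<Sum>A + \<Sum>B" arbitrary: A B v rule: less_induct)
  case less
  show ?case
  proof (cases "\<Sum>A + \<Sum>B = 0")
    case True
    then have "A = {} \<or> A = {0}" "B = {} \<or> B = {0}"
      using sum_eq_0_subset less.prems by auto
    then show ?thesis
      using less.prems(3) by (auto simp: choose_two_Suc numeral_2_eq_2 crossing_def)
  next
    case False
    let ?T = "welter_nat A XOR welter_nat B"
    have "v < ?T \<or> v = ?T \<and> odd (card B + (card A + card B choose 2))"
      by (rule less.prems(3))
    then have v: "v div 2 < ?T div 2 \<or> v div 2 = ?T div 2 \<and>
        (even v \<and> odd ?T \<or> odd v = odd ?T \<and> odd (card B + (card A + card B choose 2)))"
      unfolding nat_less_halves[of v] by blast
    \<comment> \<open>The part of the argument common to both ways of pairing the halves as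
      \<open>(C, D)\<close> and \<open>(E, F)\<close>.\<close>
    have split: "crossing A B v"
      if fin: "finite C" "finite D" "finite E" "finite F"
        and less': "\<Sum>C + \<Sum>D < \<Sum>A + \<Sum>B" "\<Sum>E + \<Sum>F < \<Sum>A + \<Sum>B"
        and T: "?T div 2 = (welter_nat C XOR welter_nat D) XOR (welter_nat E XOR welter_nat F)"
        and parity: "even v \<and> odd ?T \<or> odd v = odd ?T \<and> odd (card B + (card A + card B choose 2)) \<Longrightarrow>
          odd (card D + (card C + card D choose 2)) \<or> odd (card F + (card E + card F choose 2))"
        and lift: "crossing C D (v div 2 XOR (welter_nat E XOR welter_nat F)) \<Longrightarrow> crossing A B v"
          "crossing E F (v div 2 XOR (welter_nat C XOR welter_nat D)) \<Longrightarrow> crossing A B v"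
      for C D E F
    proof -
      let ?u = "welter_nat C XOR welter_nat D" and ?w = "welter_nat E XOR welter_nat F"
      note IH = less.hyps[OF less'(1) fin(1,2), of "v div 2 XOR ?w", THEN lift(1)]
        less.hyps[OF less'(2) fin(3,4), of "v div 2 XOR ?u", THEN lift(2)]
      from v show ?thesis
      proof
        assume "v div 2 < ?T div 2"
        then have "v div 2 < ?u XOR ?w" unfolding T .
        then show ?thesis
          by (rule xor_lessE) (use IH in blast)+
      next
        assume "v div 2 = ?T div 2 \<and>
          (even v \<and> odd ?T \<or> odd v = odd ?T \<and> odd (card B + (card A + card B choose 2)))"
        moreover from this have "v div 2 XOR ?w = ?u" "v div 2 XOR ?u = ?w"
          unfolding T by (simp_all add: xor_ac)
        ultimately show ?thesis
          using parity IH by blast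
      qed
    qed
    let ?A0 = "half 0 A" and ?A1 = "half 1 A" and ?B0 = "half 0 B" and ?B1 = "half 1 B"
    have fin: "finite (half e A)" "finite (half e B)" for e
      using less.prems by auto
    have card: "card A = card ?A0 + card ?A1" "card B = card ?B0 + card ?B1"
      using card_half less.prems(1,2) by blast+
    have less': "\<Sum>?A0 + \<Sum>?B0 < \<Sum>A + \<Sum>B" "\<Sum>?A1 + \<Sum>?B1 < \<Sum>A + \<Sum>B"
      "\<Sum>?A0 + \<Sum>?B1 < \<Sum>A + \<Sum>B" "\<Sum>?B0 + \<Sum>?A1 < \<Sum>A + \<Sum>B"
      using False sum_half[OF less.prems(1)] sum_half[OF less.prems(2)] by linarith+
    have odd: "odd ?T \<longleftrightarrow> odd (card ?A1 + (card ?A0 + card ?A1 choose 2))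
        \<noteq> odd (card ?B1 + (card ?B0 + card ?B1 choose 2))"
      unfolding odd_xor odd_welter_nat[OF less.prems(1)] odd_welter_nat[OF less.prems(2)] card ..
    have T: "?T div 2 = (welter_nat ?A0 XOR welter_nat ?B0) XOR (welter_nat ?A1 XOR welter_nat ?B1)"
      "?T div 2 = (welter_nat ?A0 XOR welter_nat ?B1) XOR (welter_nat ?B0 XOR welter_nat ?A1)"
      unfolding xor_div_2 welter_nat_div_2[OF less.prems(1)] welter_nat_div_2[OF less.prems(2)]
      by (simp_all only: xor_ac)
    show ?thesis
    proof (cases "odd v \<longleftrightarrow> odd ?T \<noteq> even (card A + card B)")
      case True
      show ?thesis
      proof (rule split[OF fin fin less'(1,2) T(1)])
        show "crossing A B v"
          if "crossing ?A0 ?B0 (v div 2 XOR (welter_nat ?A1 XOR welter_nat ?B1))"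
          using that True crossing_half[OF less.prems(1,2), of 0 0 v] by simp
        show "crossing A B v"
          if "crossing ?A1 ?B1 (v div 2 XOR (welter_nat ?A0 XOR welter_nat ?B0))"
          using that True crossing_half[OF less.prems(1,2), of 1 1 v] by simp
        show "odd (card ?B0 + (card ?A0 + card ?B0 choose 2)) \<or>
            odd (card ?B1 + (card ?A1 + card ?B1 choose 2))"
          if "even v \<and> odd ?T \<or> odd v = odd ?T \<and> odd (card B + (card A + card B choose 2))"
          \<comment> \<open>Expanding the binomial coefficients leaves a propositional statement about the parities
            of the four cardinalities \<open>c\<close> and of their \<open>c choose 2\<close>.\<close>
          using that True unfolding odd card even_choose_two_add even_add by argo
      qed
    next
      case False
      show ?thesis
      proof (rule split[OF fin(1,2) fin(2,1) less'(3,4) T(2)])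
        show "crossing A B v"
          if "crossing ?A0 ?B1 (v div 2 XOR (welter_nat ?B0 XOR welter_nat ?A1))"
          using that False crossing_half[OF less.prems(1,2), of 0 1 v] by (simp add: xor_ac)
        show "crossing A B v"
          if "crossing ?B0 ?A1 (v div 2 XOR (welter_nat ?A0 XOR welter_nat ?B1))"
          using that False crossing_half_swap[OF less.prems(1,2), of v] by simp
        show "odd (card ?B1 + (card ?A0 + card ?B1 choose 2)) \<or>
            odd (card ?A1 + (card ?B0 + card ?A1 choose 2))"
          if "even v \<and> odd ?T \<or> odd v = odd ?T \<and> odd (card B + (card A + card B choose 2))"
          using that False unfolding odd card even_choose_two_add even_add by argo
      qed
    qed
  qed
qed

text \<open>
  Welter's theorem, the part that provides moves. A target with the last digit of \<open>[S]\<close> is reached inside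
  one of the halves, any other target by a move that changes the parity of a coin.
\<close>
lemma welter_nat_move:
  assumes "finite S" "v < welter_nat S"
  obtains a b where "a \<in> S" "b < a" "b \<notin> S" "welter_nat (insert b (S - {a})) = v"
proof -
  have "\<exists>a\<in>S. \<exists>b<a. b \<notin> S \<and> welter_nat (insert b (S - {a})) = v"
    using assms
  proof (induction "\<Sum>S" arbitrary: S v rule: less_induct)
    case less
    note S = less.prems(1)
    have nonzero: "\<Sum>S \<noteq> 0"
    proof
      assume "\<Sum>S = 0"
      then have "S = {} \<or> S = {0}" by (rule sum_eq_0_subset[OF S])
      then show False using less.prems(2) by auto
    qed
    have odd_move: "odd (welter_nat (insert b (S - {a}))) \<longleftrightarrow> odd (welter_nat S) \<noteq> odd (a + b)"
      if "a \<in> S" "b \<notin> S" for a b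
      using that S odd_welter_nat_insert[of "S - {a}" a] odd_welter_nat_insert[of "S - {a}" b]
      by (auto simp: insert_absorb)
    show ?case
    proof (cases "odd v \<longleftrightarrow> odd (welter_nat S)")
      case True
      have lift: ?thesis
        if v: "v div 2 XOR welter_nat (half (1 - e) S) < welter_nat (half e S)" and e: "e \<le> 1" for e
      proof -
        obtain x y where xy: "x \<in> half e S" "y < x" "y \<notin> half e S"
          "welter_nat (insert y (half e S - {x})) = v div 2 XOR welter_nat (half (1 - e) S)"
          using less.hyps[OF sum_half_less[OF S e nonzero] finite_half[OF S] v] by blast
        let ?a = "2 * x + e" and ?b = "2 * y + e"
        have ab: "?a \<in> S" "?b < ?a" "?b \<notin> S" using xy by auto
        have "welter_nat (insert ?b (S - {?a})) = v"
        proof (rule nat_eq_halves)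
          show "welter_nat (insert ?b (S - {?a})) div 2 = v div 2"
            using S xy(4)
            by (simp only: welter_nat_insert_div_2[OF _ e] half_remove[OF e] finite_Diff
                xor.assoc xor_self_eq xor.right_neutral)
          show "odd (welter_nat (insert ?b (S - {?a}))) = odd v"
            using odd_move[OF ab(1,3)] True by auto
        qed
        with ab show ?thesis by blast
      qed
      have "v div 2 < welter_nat (half 0 S) XOR welter_nat (half 1 S)"
        using less.prems(2) True unfolding welter_nat_div_2[OF S, symmetric] nat_less_halves[of v]
        by blast
      then show ?thesis
        by (rule xor_lessE) (use lift[of 0] lift[of 1] in auto)
    next
      case False
      have "crossing (half 0 S) (half 1 S) (v div 2)"
      proof (rule crossing_exists)
        have "v div 2 < welter_nat S div 2 \<or> v div 2 = welter_nat S div 2 \<and> odd (welter_nat S)"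
          using less.prems(2) nat_less_halves by blast
        then show "v div 2 < welter_nat (half 0 S) XOR welter_nat (half 1 S) \<or>
          v div 2 = welter_nat (half 0 S) XOR welter_nat (half 1 S) \<and>
          odd (card (half 1 S) + (card (half 0 S) + card (half 1 S) choose 2))"
          unfolding welter_nat_div_2[OF S] odd_welter_nat[OF S] card_half[OF S] .
      qed (use S in auto)
      then obtain x y e where e: "e \<le> 1" and xy: "x \<in> half e S" "y \<notin> half (1 - e) S"
        "2 * y + (1 - e) < 2 * x + e"
        "welter_nat (half e S - {x}) XOR welter_nat (insert y (half (1 - e) S)) = v div 2"
        unfolding crossing_def
      proof (elim disjE bexE exE conjE)
        fix x y
        assume "x \<in> half 0 S" "y \<notin> half 1 S" "y < x"
          "welter_nat (half 0 S - {x}) XOR welter_nat (insert y (half 1 S)) = v div 2"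
        then show thesis by (intro that[of 0 x y]) auto
      next
        fix x y
        assume "y \<in> half 1 S" "x \<notin> half 0 S" "x \<le> y"
          "welter_nat (half 1 S - {y}) XOR welter_nat (insert x (half 0 S)) = v div 2"
        then show thesis by (intro that[of 1 y x]) auto
      qed
      have "1 - (1 - e) = e" using e by simp
      let ?a = "2 * x + e" and ?b = "2 * y + (1 - e)"
      have ab: "?a \<in> S" "?b < ?a" "?b \<notin> S" using xy by auto
      have "welter_nat (insert ?b (S - {?a})) = v"
      proof (rule nat_eq_halves)
        show "welter_nat (insert ?b (S - {?a})) div 2 = v div 2"
          using S xy(4) \<open>1 - (1 - e) = e\<close>
          by (simp only: welter_nat_insert_div_2[OF _ diff_le_self] half_remove[OF e] finite_Diff
              xor.commute)
        show "odd (welter_nat (insert ?b (S - {?a}))) = odd v"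
          using odd_move[OF ab(1,3)] False half_cases[OF e] by auto
      qed
      with ab show ?thesis by blast
    qed
  qed
  then show thesis using that by blast
qed

section \<open>Division with remainder and finite ordinals\<close>

lemma ordinal_add_less_iff [simp]: "a + b < a + c \<longleftrightarrow> b < c" for a b c :: "'a ordinal"
  using ordinal_add_less[of b c a] ordinal_add_less[of c b a] by (metis less_asym linorder_cases)

lemma ordinal_add_left_cancel [simp]: "a + b = a + c \<longleftrightarrow> b = c" for a b c :: "'a ordinal"
  using ordinal_add_less_iff by (metis less_irrefl linorder_cases)

lemma ordinal_not_less_zero [simp]: "\<not> a < 0" for a :: "'a ordinal"
  by (simp add: not_less)

lemma ordinal_zero_less_iff [simp]: "0 < a \<longleftrightarrow> a \<noteq> 0" for a :: "'a ordinal"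
  by (auto simp: order_less_le)

lemma ordinal_less_addE:
  fixes a b c :: "'a ordinal"
  assumes "c < a + b"
  obtains "c < a" | e where "e < b" "c \<le> a + e"
proof -
  have "\<exists>x\<in>insert a ((\<lambda>e. ord_succ (a + e)) ` {..<b}). c < x"
    using assms less_cSup_iff[of "insert a ((\<lambda>e. ord_succ (a + e)) ` {..<b})" c]
    by (simp add: plus_ordinal.simps[of a b])
  then show thesis using that by (auto simp: less_ord_succ_iff)
qed

lemma ordinal_less_multE:
  fixes a b c :: "'a ordinal"
  assumes "c < a * b"
  obtains e where "e < b" "c < a * e + a"
proof -
  have "b \<noteq> 0" using assms by (auto simp: ordinal_mult_0)
  then have "0 \<in> {..<b}" by simp
  then have "{..<b} \<noteq> {}" by blast
  then have "\<exists>x\<in>(\<lambda>e. a * e + a) ` {..<b}. c < x"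
    using assms less_cSup_iff[of "(\<lambda>e. a * e + a) ` {..<b}" c]
    by (simp add: times_ordinal.simps[of a b])
  then show thesis using that by auto
qed

lemma ordinal_subtract:
  fixes a b :: "'a ordinal"
  assumes "a \<le> b"
  obtains c where "a + c = b"
proof -
  define c where "c = (LEAST c. b \<le> a + c)"
  have "b \<le> a + b" using ordinal_add_mono[of 0 a b b] by (simp add: ordinal_zero_add)
  then have "b \<le> a + c" unfolding c_def by (rule LeastI)
  moreover have "\<not> b < a + c"
  proof
    assume "b < a + c"
    then show False
      by (rule ordinal_less_addE) (use assms not_less_Least[of _ "\<lambda>c. b \<le> a + c"] in \<open>auto simp: c_def\<close>)
  qed
  ultimately show thesis using that by force
qed

text \<open>
  The quotient is the least \<open>q\<close> with \<open>c < a * q + a\<close>; by minimality \<open>a * q \<le> c\<close>, and the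
  rest is obtained by subtraction.
\<close>
lemma ordinal_division:
  fixes a b c :: "'a ordinal"
  assumes "c < a * b"
  obtains q r where "q < b" "r < a" "c = a * q + r"
proof -
  define q where "q = (LEAST q. c < a * q + a)"
  obtain e where e: "e < b" "c < a * e + a" using assms by (rule ordinal_less_multE)
  have q: "c < a * q + a" unfolding q_def using e(2) by (rule LeastI)
  have "q \<le> e" unfolding q_def using e(2) by (rule Least_le)
  have "a * q \<le> c"
  proof (rule ccontr)
    assume "\<not> a * q \<le> c"
    then have "c < a * q" by simp
    then obtain e where "e < q" "c < a * e + a" by (rule ordinal_less_multE)
    then show False using not_less_Least[of e] unfolding q_def by blast
  qed
  then obtain r where r: "a * q + r = c" by (rule ordinal_subtract)
  with q have "r < a" by auto
  with r e(1) \<open>q \<le> e\<close> show thesis by (intro that[of q r]) auto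
qed

text \<open>
  Numbers \<open>a * q + r\<close> with \<open>r < a\<close> are ordered lexicographically. This serves for the
  decomposition modulo \<open>\<omega>\<close> as well as for the leading terms of Cantor normal forms.
\<close>
lemma ordinal_mult_add_less:
  fixes a q q' r r' :: "'a ordinal"
  assumes "q < q'" "r < a"
  shows "a * q + r < a * q' + r'"
proof -
  have "a * q + r < a * q + a" using assms(2) by simp
  also have "\<dots> \<le> a * q'" using assms(1) by (rule ordinal_mult_le)
  also have "\<dots> \<le> a * q' + r'" by (rule ordinal_add_le)
  finally show ?thesis .
qed

lemma ord_of_nat_less_Suc: "ord_of_nat n < ord_of_nat (Suc n)"
  by simp

lemma ord_of_nat_less_iff [simp]: "ord_of_nat m < ord_of_nat n \<longleftrightarrow> m < n"
  using strict_mono_less[of ord_of_nat m n] by (simp add: strict_mono_Suc_iff)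

lemma ord_of_nat_eq_iff [simp]: "ord_of_nat m = ord_of_nat n \<longleftrightarrow> m = n"
  by (metis ord_of_nat_less_iff less_irrefl linorder_neqE_nat)

lemma ord_of_nat_less_omega [simp]: "ord_of_nat n < ord_omega"
  using ord_of_nat_less_Suc ord_of_nat_le_omega by (rule less_le_trans)

lemma less_ord_of_natE:
  assumes "a < ord_of_nat n"
  obtains m where "a = ord_of_nat m" "m < n"
  using assms by (induction n) (auto simp: less_ord_succ_iff order_le_less dest: leD)

lemma less_omegaE:
  assumes "a < ord_omega"
  obtains m where "a = ord_of_nat m"
proof -
  obtain n where "a < ord_of_nat n"
    using assms less_cSup_iff[OF _ bdd_above_range_ord_of_nat] unfolding ord_omega_def by auto
  then show thesis using that by (rule less_ord_of_natE)
qed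

text \<open>
  Multiplication by \<open>a\<close> is strictly increasing, so \<open>a * b < b\<close> would start an infinite descent
  \<open>b > a * b > a * (a * b) > \<dots>\<close>. The bound makes \<open>ordinal_division\<close> applicable to every ordinal.
\<close>
lemma ordinal_le_mult:
  fixes a b :: "'a ordinal"
  assumes "a \<noteq> 0"
  shows "b \<le> a * b"
proof (induction b rule: less_induct)
  case (less b)
  show ?case
  proof (rule ccontr)
    assume "\<not> b \<le> a * b"
    then have "a * b < b" by simp
    from less[OF this] have "a * b + 0 \<le> a * (a * b) + 0" by (simp add: ordinal_add_0)
    also have "\<dots> < a * b + 0"
      using assms \<open>a * b < b\<close> by (intro ordinal_mult_add_less) simp_all
    finally show False by simp
  qed
qed

section \<open>Quotient and remainder modulo omega\<close>

lemma omega_decomposition_unique: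
  assumes "ord_omega * k + ord_of_nat m = ord_omega * l + ord_of_nat n"
  shows "k = l \<and> m = n"
proof -
  have "\<not> k < l" "\<not> l < k"
    using ordinal_mult_add_less[OF _ ord_of_nat_less_omega] assms by (metis less_irrefl)+
  then have "k = l" by simp
  then show ?thesis using assms by simp
qed

lemma omega_quot_rem_eq [simp]:
  "omega_quot (ord_omega * l + ord_of_nat m) = l"
  "omega_rem (ord_omega * l + ord_of_nat m) = m"
  unfolding omega_quot_def omega_rem_def
  by (rule the_equality; use omega_decomposition_unique in blast)+

lemma omega_decomposition: "ord_omega * omega_quot a + ord_of_nat (omega_rem a) = a"
proof -
  have "ord_of_nat 0 < (ord_omega :: 'a ordinal)" by (rule ord_of_nat_less_omega)
  then have "a \<le> ord_omega * a" by (intro ordinal_le_mult) auto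
  also have "\<dots> < ord_omega * ord_succ a"
    using ordinal_mult_add_less[of a "ord_succ a" 0 ord_omega 0] \<open>ord_of_nat 0 < ord_omega\<close>
    by (simp add: ordinal_add_0)
  finally obtain q r where "r < ord_omega" "a = ord_omega * q + r"
    by (rule ordinal_division)
  then show ?thesis by (auto elim!: less_omegaE)
qed

lemma omega_less_iff:
  "ord_omega * k + ord_of_nat m < ord_omega * l + ord_of_nat n \<longleftrightarrow> k < l \<or> k = l \<and> m < n"
  using ordinal_mult_add_less[OF _ ord_of_nat_less_omega]
  by (metis linorder_cases less_asym ordinal_add_less_iff ord_of_nat_less_iff)

section \<open>Cantor normal form\<close>

text \<open>
  Normal forms along a given decreasing list of exponents, on which coefficients may vanish. This
  allows induction on the list and a common list of exponents for two ordinals.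
\<close>
definition cantor_list :: "'a ordinal list \<Rightarrow> ('a ordinal \<Rightarrow> nat) \<Rightarrow> 'a ordinal" where
  "cantor_list L f = foldr (\<lambda>\<gamma> s. omega_pow \<gamma> * ord_of_nat (f \<gamma>) + s) L 0"

lemma cantor_list_simps [simp]:
  "cantor_list [] f = 0"
  "cantor_list (\<gamma> # L) f = omega_pow \<gamma> * ord_of_nat (f \<gamma>) + cantor_list L f"
  by (simp_all add: cantor_list_def)

lemma cantor_list_cong: "(\<And>\<gamma>. \<gamma> \<in> set L \<Longrightarrow> f \<gamma> = g \<gamma>) \<Longrightarrow> cantor_list L f = cantor_list L g"
  by (induction L) auto

lemma cantor_list_filter: "cantor_list (filter (\<lambda>\<gamma>. f \<gamma> \<noteq> 0) L) f = cantor_list L f"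
  by (induction L) (auto simp: ordinal_mult_0 ordinal_zero_add)

lemma cantor_sum_eq_cantor_list:
  assumes "sorted_wrt (>) L" "{\<gamma>. f \<gamma> \<noteq> 0} \<subseteq> set L"
  shows "cantor_sum f = cantor_list L f"
proof -
  let ?L = "filter (\<lambda>\<gamma>. f \<gamma> \<noteq> 0) L"
  have "sorted_wrt (<) (rev ?L)"
    using assms(1) by (simp add: sorted_wrt_rev sorted_wrt_filter)
  moreover have "set (rev ?L) = {\<gamma>. f \<gamma> \<noteq> 0}" using assms(2) by auto
  ultimately have "sorted_list_of_set {\<gamma>. f \<gamma> \<noteq> 0} = rev ?L"
    by (metis List.finite_set sorted_list_of_set.idem_if_sorted_distinct strict_sorted_iff)
  then have "cantor_sum f = cantor_list ?L f"
    by (simp add: cantor_sum_def cantor_list_def)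
  then show ?thesis by (simp only: cantor_list_filter)
qed

text \<open>
  Each leading term \<open>\<omega>\<^sup>\<gamma> \<cdot> n\<close> with what follows stays below \<open>\<omega>\<^sup>\<gamma> \<cdot> (n + 1) < \<omega>\<^sup>\<gamma> \<cdot> \<omega> \<le> \<omega>\<^sup>\<delta>\<close>.
\<close>
lemma cantor_list_less:
  assumes "sorted_wrt (>) L" "\<And>\<gamma>. \<gamma> \<in> set L \<Longrightarrow> \<gamma> < \<delta>"
  shows "cantor_list L f < omega_pow \<delta>"
  using assms
proof (induction L arbitrary: \<delta>)
  case Nil
  have "0 < (1 :: 'a ordinal)" by (simp add: one_ordinal_def)
  then have "0 < omega_pow \<delta>" using one_le_omega_pow by (rule less_le_trans)
  then show ?case by simp
next
  case (Cons \<gamma> L)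
  have "cantor_list (\<gamma> # L) f < omega_pow \<gamma> * ord_omega + 0"
    unfolding cantor_list_simps using Cons by (intro ordinal_mult_add_less Cons.IH) auto
  also have "\<dots> \<le> omega_pow \<delta>"
    using Cons.prems(2) by (simp add: ordinal_add_0 omega_pow_le)
  finally show ?case .
qed

text \<open>
  Equal leading terms cancel; at the first difference the lower terms cannot make up for
  the larger coefficient, by \<open>cantor_list_less\<close>.
\<close>
lemma cantor_list_less_cantor_list:
  assumes "sorted_wrt (>) L" "\<delta> \<in> set L" "f \<delta> < g \<delta>" "\<And>\<gamma>. \<delta> < \<gamma> \<Longrightarrow> f \<gamma> = g \<gamma>"
  shows "cantor_list L f < cantor_list L g"
  using assms(1,2)
proof (induction L)
  case (Cons \<gamma> L)
  show ?case
  proof (cases "\<gamma> = \<delta>")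
    case True
    then show ?thesis
      using Cons.prems assms(3) by (auto intro!: ordinal_mult_add_less cantor_list_less)
  next
    case False
    then have "f \<gamma> = g \<gamma>" using Cons.prems assms(4) by auto
    then show ?thesis using Cons False by simp
  qed
qed simp

lemma finite_ordinals_listE:
  fixes A :: "'a ordinal set"
  assumes "finite A"
  obtains L where "sorted_wrt (>) L" "set L = A"
  using assms by (intro that[of "rev (sorted_list_of_set A)"]) (auto simp: sorted_wrt_rev)

definition finite_support :: "('b \<Rightarrow> nat) \<Rightarrow> bool" where
  "finite_support f \<longleftrightarrow> finite {\<gamma>. f \<gamma> \<noteq> 0}"

lemma cantor_sum_less:
  assumes "finite_support f" "finite_support g" "f \<delta> < g \<delta>" "\<And>\<gamma>. \<delta> < \<gamma> \<Longrightarrow> f \<gamma> = g \<gamma>"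
  shows "cantor_sum f < cantor_sum g"
proof -
  have "finite ({\<gamma>. f \<gamma> \<noteq> 0} \<union> {\<gamma>. g \<gamma> \<noteq> 0})"
    using assms(1,2) by (simp add: finite_support_def)
  then obtain L where L: "sorted_wrt (>) L" "set L = {\<gamma>. f \<gamma> \<noteq> 0} \<union> {\<gamma>. g \<gamma> \<noteq> 0}"
    by (rule finite_ordinals_listE)
  then show ?thesis
    using assms(3,4) cantor_list_less_cantor_list[OF L(1), of \<delta> f g]
    by (auto simp: cantor_sum_eq_cantor_list[OF L(1)])
qed

lemma finite_support_greatest_difference:
  fixes f g :: "'a ordinal \<Rightarrow> nat"
  assumes "finite_support f" "finite_support g" "f \<noteq> g"
  obtains \<delta> where "f \<delta> \<noteq> g \<delta>" "\<And>\<gamma>. \<delta> < \<gamma> \<Longrightarrow> f \<gamma> = g \<gamma>"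
proof -
  let ?D = "{\<gamma>. f \<gamma> \<noteq> g \<gamma>}"
  have "?D \<subseteq> {\<gamma>. f \<gamma> \<noteq> 0} \<union> {\<gamma>. g \<gamma> \<noteq> 0}" by auto
  then have fin: "finite ?D"
    using assms(1,2) finite_subset unfolding finite_support_def by blast
  moreover have "?D \<noteq> {}" using assms(3) by auto
  ultimately have "Max ?D \<in> ?D" by (rule Max_in)
  moreover have "f \<gamma> = g \<gamma>" if "Max ?D < \<gamma>" for \<gamma>
    using Max_ge[OF fin, of \<gamma>] that by force
  ultimately show thesis using that by blast
qed

lemma cantor_sum_inject:
  assumes "finite_support f" "finite_support g" "cantor_sum f = cantor_sum g"
  shows "f = g"
proof (rule ccontr)
  assume "f \<noteq> g"
  with assms(1,2) obtain \<delta> where "f \<delta> \<noteq> g \<delta>" "\<And>\<gamma>. \<delta> < \<gamma> \<Longrightarrow> f \<gamma> = g \<gamma>"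
    by (rule finite_support_greatest_difference) blast
  then show False
    using cantor_sum_less[OF assms(1,2), of \<delta>] cantor_sum_less[OF assms(2,1), of \<delta>] assms(3)
    by (metis less_irrefl linorder_neqE_nat)
qed

text \<open>
  As \<open>\<omega>\<^sup>\<delta>\<close> is a supremum, a nonzero \<open>\<alpha> < \<omega>\<^sup>\<delta>\<close> lies below \<open>\<omega>\<^sup>b \<cdot> \<omega>\<close> for some
  \<open>b < \<delta>\<close>. Division by \<open>\<omega>\<^sup>b\<close> gives a finite quotient, the coefficient of \<open>\<omega>\<^sup>b\<close>, and a remainder below
  \<open>\<omega>\<^sup>b\<close>, whose exponents are below \<open>b\<close>. Here \<open>b\<close> need not be the leading exponent
  of \<open>\<alpha>\<close>, because zero coefficients are permitted.
\<close>
lemma cantor_list_exists: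
  assumes "\<alpha> < omega_pow \<delta>"
  shows "\<exists>L f. sorted_wrt (>) L \<and> (\<forall>\<gamma>\<in>set L. \<gamma> < \<delta>) \<and> cantor_list L f = \<alpha>"
  using assms
proof (induction \<delta> arbitrary: \<alpha> rule: less_induct)
  case (less \<delta>)
  show ?case
  proof (cases "\<alpha> = 0")
    case True
    then show ?thesis by (intro exI[of _ "[]"]) simp
  next
    case False
    then have "1 \<le> \<alpha>" by (simp add: one_ordinal_def ord_succ_le_iff order_less_le)
    moreover have "\<exists>x\<in>insert 1 ((\<lambda>b. omega_pow b * ord_omega) ` {..<\<delta>}). \<alpha> < x"
      using less.prems less_cSup_iff[of "insert 1 ((\<lambda>b. omega_pow b * ord_omega) ` {..<\<delta>})" \<alpha>]
      by (simp add: omega_pow.simps[of \<delta>])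
    ultimately obtain b where b: "b < \<delta>" "\<alpha> < omega_pow b * ord_omega"
      by (auto dest: leD)
    from b(2) obtain q r where "q < ord_omega" and r: "r < omega_pow b" "\<alpha> = omega_pow b * q + r"
      by (rule ordinal_division)
    then obtain n where n: "q = ord_of_nat n" by (auto elim: less_omegaE)
    obtain L f where L: "sorted_wrt (>) L" "\<forall>\<gamma>\<in>set L. \<gamma> < b" "cantor_list L f = r"
      using less.IH[OF b(1) r(1)] by blast
    define g where "g = f(b := n)"
    have "cantor_list L g = cantor_list L f"
      by (rule cantor_list_cong) (use L(2) in \<open>auto simp: g_def\<close>)
    then have "cantor_list (b # L) g = \<alpha>" using L(3) r(2) n by (simp add: g_def)
    then show ?thesis
      using L(1,2) b(1) by (intro exI[of _ "b # L"] exI[of _ g]) auto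
  qed
qed

lemma le_omega_pow: "\<alpha> \<le> omega_pow \<alpha>"
proof (rule ccontr)
  have mono: "omega_pow a < omega_pow b" if "a < b" for a b :: "'a ordinal"
    using cantor_list_less[of "[a]" b "\<lambda>_. 1"] that
    by (simp add: ordinal_mult_succ ordinal_mult_0 ordinal_zero_add ordinal_add_0)
  assume "\<not> \<alpha> \<le> omega_pow \<alpha>"
  then have "\<exists>\<alpha>. omega_pow \<alpha> < (\<alpha> :: 'a ordinal)" by (auto simp: not_le)
  then show False
    using mono LeastI_ex[of "\<lambda>\<alpha>. omega_pow \<alpha> < (\<alpha> :: 'a ordinal)"]
      not_less_Least[of _ "\<lambda>\<alpha>. omega_pow \<alpha> < (\<alpha> :: 'a ordinal)"] by blast
qed

lemma cantor_sum_exists: "\<exists>f. finite_support f \<and> cantor_sum f = \<alpha>"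
proof -
  have "\<alpha> < ord_succ \<alpha>" "ord_succ \<alpha> \<le> omega_pow (ord_succ \<alpha>)"
    by (simp_all add: le_omega_pow)
  then have "\<alpha> < omega_pow (ord_succ \<alpha>)" by (rule less_le_trans)
  then obtain L f where L: "sorted_wrt (>) L" "cantor_list L f = \<alpha>"
    using cantor_list_exists by blast
  define g where "g \<gamma> = (if \<gamma> \<in> set L then f \<gamma> else 0)" for \<gamma>
  have g: "{\<gamma>. g \<gamma> \<noteq> 0} \<subseteq> set L" by (auto simp: g_def)
  then have "cantor_sum g = cantor_list L g" by (rule cantor_sum_eq_cantor_list[OF L(1)])
  also have "\<dots> = \<alpha>" unfolding L(2)[symmetric] by (rule cantor_list_cong) (simp add: g_def)
  finally show ?thesis using g finite_subset unfolding finite_support_def by blast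
qed

lemma cantor_coeff_cantor_sum: "finite_support f \<Longrightarrow> cantor_coeff (cantor_sum f) = f"
  unfolding cantor_coeff_def
  by (rule the_equality) (auto simp: finite_support_def intro: cantor_sum_inject)

lemma
  shows finite_support_cantor_coeff: "finite_support (cantor_coeff \<alpha>)"
    and cantor_sum_cantor_coeff: "cantor_sum (cantor_coeff \<alpha>) = \<alpha>"
  using cantor_sum_exists[of \<alpha>] cantor_coeff_cantor_sum by metis+

lemma cantor_coeff_inject: "cantor_coeff \<alpha> = cantor_coeff \<beta> \<Longrightarrow> \<alpha> = \<beta>"
  by (metis cantor_sum_cantor_coeff)

lemma cantor_coeff_less:
  assumes "\<alpha> < \<beta>"
  obtains \<delta> where "cantor_coeff \<alpha> \<delta> < cantor_coeff \<beta> \<delta>"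
    "\<And>\<gamma>. \<delta> < \<gamma> \<Longrightarrow> cantor_coeff \<alpha> \<gamma> = cantor_coeff \<beta> \<gamma>"
proof -
  have "cantor_coeff \<alpha> \<noteq> cantor_coeff \<beta>" using assms cantor_coeff_inject by blast
  with finite_support_cantor_coeff finite_support_cantor_coeff
  obtain \<delta> where \<delta>: "cantor_coeff \<alpha> \<delta> \<noteq> cantor_coeff \<beta> \<delta>"
    "\<And>\<gamma>. \<delta> < \<gamma> \<Longrightarrow> cantor_coeff \<alpha> \<gamma> = cantor_coeff \<beta> \<gamma>"
    by (rule finite_support_greatest_difference) blast
  moreover have "\<not> cantor_coeff \<beta> \<delta> < cantor_coeff \<alpha> \<delta>"
    using cantor_sum_less[OF finite_support_cantor_coeff finite_support_cantor_coeff, of \<beta> \<delta> \<alpha>] \<delta>(2) assms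
    by (auto simp: cantor_sum_cantor_coeff)
  ultimately show thesis using that linorder_neqE_nat by blast
qed

section \<open>Transfinite Nim\<close>

lemma finite_support_xor:
  "finite_support f \<Longrightarrow> finite_support g \<Longrightarrow> finite_support (\<lambda>\<gamma>. f \<gamma> XOR g \<gamma>)"
  unfolding finite_support_def
  by (rule finite_subset[of _ "{\<gamma>. f \<gamma> \<noteq> 0} \<union> {\<gamma>. g \<gamma> \<noteq> 0}"]) auto

lemma finite_support_nim_sum_nat:
  "(\<And>i. i \<in> I \<Longrightarrow> finite_support (f i)) \<Longrightarrow> finite_support (\<lambda>\<gamma>. nim_sum_nat (\<lambda>i. f i \<gamma>) I)"
proof (induction I rule: infinite_finite_induct)
  case (insert i I)
  then show ?case using finite_support_xor[of "f i"] by simp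
qed (simp_all add: finite_support_def)

lemma cantor_coeff_nim_sum:
  "cantor_coeff (nim_sum as) \<gamma> = nim_sum_nat (\<lambda>i. cantor_coeff (as ! i) \<gamma>) {..<length as}"
  unfolding nim_sum_def
  by (subst cantor_coeff_cantor_sum)
    (simp_all add: finite_support_nim_sum_nat finite_support_cantor_coeff)

text \<open>
  Exchanging one heap changes every coefficient of the nim-sum by the nim-sum of the old and the new
  coefficient.
\<close>
lemma cantor_coeff_nim_sum_update:
  assumes "i < length as"
  shows "cantor_coeff (nim_sum (as[i := b])) \<gamma> =
    cantor_coeff (nim_sum as) \<gamma> XOR (cantor_coeff (as ! i) \<gamma> XOR cantor_coeff b \<gamma>)"
proof -
  have i: "i \<in> {..<length as}" using assms by simp
  have "nim_sum_nat (\<lambda>j. cantor_coeff (as[i := b] ! j) \<gamma>) ({..<length as} - {i})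
      = nim_sum_nat (\<lambda>j. cantor_coeff (as ! j) \<gamma>) ({..<length as} - {i})"
    by (rule nim.cong) auto
  then show ?thesis
    using assms by (simp add: cantor_coeff_nim_sum nim.remove[OF _ i] xor_ac)
qed

lemma nim_sum_update_inject:
  assumes "i < length as" "nim_sum (as[i := b]) = nim_sum as"
  shows "b = as ! i"
proof (rule cantor_coeff_inject, rule ext)
  fix \<gamma>
  have "cantor_coeff (nim_sum as) \<gamma> =
      cantor_coeff (nim_sum as) \<gamma> XOR (cantor_coeff (as ! i) \<gamma> XOR cantor_coeff b \<gamma>)"
    using cantor_coeff_nim_sum_update[OF assms(1), of b \<gamma>] assms(2) by simp
  then show "cantor_coeff b \<gamma> = cantor_coeff (as ! i) \<gamma>"
    by (metis xor_cancel xor_self_eq xor.commute xor.right_neutral)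
qed

text \<open>
  The strategy of transfinite Nim. At the largest exponent \<open>\<delta>\<close> where \<open>\<mu>\<close> and the nim-sum differ, some heap
  has a coefficient that the required change lowers. The same change at the smaller exponents may go
  either way, but cannot affect the comparison.
\<close>
lemma nim_sum_move:
  assumes "\<mu> < nim_sum as"
  obtains i b where "i < length as" "b < as ! i" "nim_sum (as[i := b]) = \<mu>"
proof -
  let ?N = "cantor_coeff (nim_sum as)" and ?M = "cantor_coeff \<mu>"
  obtain \<delta> where \<delta>: "?M \<delta> < ?N \<delta>" "\<And>\<gamma>. \<delta> < \<gamma> \<Longrightarrow> ?M \<gamma> = ?N \<gamma>"
    using cantor_coeff_less[OF assms] by blast
  from \<delta>(1) have "?M \<delta> < nim_sum_nat (\<lambda>i. cantor_coeff (as ! i) \<delta>) {..<length as}"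
    by (simp only: cantor_coeff_nim_sum)
  then obtain i where i: "i < length as"
    "cantor_coeff (as ! i) \<delta> XOR (?M \<delta> XOR ?N \<delta>) < cantor_coeff (as ! i) \<delta>"
    using nim_sum_nat_lessE[OF finite_lessThan] unfolding cantor_coeff_nim_sum by (metis lessThan_iff)
  define f where "f \<gamma> = cantor_coeff (as ! i) \<gamma> XOR (?M \<gamma> XOR ?N \<gamma>)" for \<gamma>
  have f: "finite_support f"
    unfolding f_def by (intro finite_support_xor finite_support_cantor_coeff)
  define b where "b = cantor_sum f"
  have "cantor_sum f < cantor_sum (cantor_coeff (as ! i))"
    by (rule cantor_sum_less[OF f finite_support_cantor_coeff, of \<delta>])
      (use i(2) \<delta>(2) in \<open>auto simp: f_def\<close>)
  then have "b < as ! i" by (simp add: b_def cantor_sum_cantor_coeff)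
  moreover have "nim_sum (as[i := b]) = \<mu>"
  proof (rule cantor_coeff_inject, rule ext)
    fix \<gamma>
    show "cantor_coeff (nim_sum (as[i := b])) \<gamma> = ?M \<gamma>"
      unfolding cantor_coeff_nim_sum_update[OF i(1)] b_def cantor_coeff_cantor_sum[OF f] f_def
      by (simp add: xor_ac)
  qed
  ultimately show thesis using i(1) that by blast
qed

section \<open>The transfinite game\<close>

text \<open>
  The \<open>mex\<close> of the empty set is \<open>0\<close>, which covers the end positions.
\<close>
lemma grundy_eq_mex: "grundy as = mex (grundy ` {bs. legal_move as bs})"
proof (cases "\<nexists>bs. legal_move as bs")
  case True
  then have "grundy ` {bs. legal_move as bs} = {}" by blast
  with True show ?thesis by (simp add: grundy.simps[of as] mex_def zero_ordinal_def)
qed (simp add: grundy.simps[of as])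

lemma mex_eqI: "w \<notin> T \<Longrightarrow> (\<And>v. v < w \<Longrightarrow> v \<in> T) \<Longrightarrow> mex T = w"
  unfolding mex_def by (rule Least_equality) (auto simp: not_less[symmetric])

lemma finite_welter_section [simp]: "finite (welter_section as l)"
  by (simp add: welter_section_def)

definition section_sum :: "'a ordinal list \<Rightarrow> nat" where
  "section_sum as = nim_sum_nat (\<lambda>l. welter_nat (welter_section as l)) {l. welter_section as l \<noteq> {}}"

lemma welter_eq: "welter as = ord_omega * nim_sum (map omega_quot as) + ord_of_nat (section_sum as)"
  by (simp add: welter_def section_sum_def)

text \<open>
  Empty sections have value \<open>0\<close>. Sums over a common index set make positions before and after
  a move comparable.
\<close>
lemma section_sum_superset:
  assumes "finite K" "omega_quot ` set as \<subseteq> K"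
  shows "section_sum as = nim_sum_nat (\<lambda>l. welter_nat (welter_section as l)) K"
  unfolding section_sum_def
proof (rule nim.mono_neutral_left)
  show "{l. welter_section as l \<noteq> {}} \<subseteq> K"
    using assms(2) by (auto simp: welter_section_def)
qed (use assms(1) in auto)

lemma mem_welter_section: "m \<in> welter_section as l \<longleftrightarrow> ord_omega * l + ord_of_nat m \<in> set as"
proof
  assume "m \<in> welter_section as l"
  then obtain a where "a \<in> set as" "omega_quot a = l" "omega_rem a = m"
    by (auto simp: welter_section_def)
  then show "ord_omega * l + ord_of_nat m \<in> set as"
    using omega_decomposition[of a] by simp
next
  assume "ord_omega * l + ord_of_nat m \<in> set as"
  then show "m \<in> welter_section as l"
    unfolding welter_section_def by (auto intro!: exI[of _ "ord_omega * l + ord_of_nat m"])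
qed

lemma omega_pair_eq_iff [simp]:
  "ord_omega * k + ord_of_nat m = ord_omega * l + ord_of_nat n \<longleftrightarrow> k = l \<and> m = n"
  using omega_decomposition_unique by blast

lemma legal_moveI:
  "i < length as \<Longrightarrow> b < as ! i \<Longrightarrow> b \<notin> set as \<Longrightarrow> legal_move as (as[i := b])"
  by (auto simp: legal_move_def)

lemma welter_section_update:
  assumes "distinct as" "i < length as" "as ! i = ord_omega * k + ord_of_nat m"
  shows "welter_section (as[i := ord_omega * l + ord_of_nat n]) j =
    (if j = l then {n} else {}) \<union> (welter_section as j - (if j = k then {m} else {}))"
  using assms by (auto simp: mem_welter_section set_update_distinct[OF assms(1,2)])

text \<open>
  If the value stays the same, so does the nim-sum of the quotients, hence the quotient of the moved
  coin. Then only one section has changed, in one element, and injectivity of Welter's function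
  in one argument shows that the coin has not moved.
\<close>
lemma welter_legal_move_neq:
  assumes "distinct as" "legal_move as bs"
  shows "welter bs \<noteq> welter as"
proof
  assume eq: "welter bs = welter as"
  obtain i b where i: "i < length as" "b < as ! i" "b \<notin> set as" "bs = as[i := b]"
    using assms(2) by (auto simp: legal_move_def)
  obtain k m where a: "as ! i = ord_omega * k + ord_of_nat m" using omega_decomposition by metis
  obtain l n where b: "b = ord_omega * l + ord_of_nat n" using omega_decomposition by metis
  have "nim_sum ((map omega_quot as)[i := omega_quot b]) = nim_sum (map omega_quot as)"
    and sections: "section_sum bs = section_sum as"
    using eq by (simp_all add: welter_eq i(4) map_update)
  then have "omega_quot b = omega_quot (as ! i)"
    using i(1) nim_sum_update_inject[of i "map omega_quot as" "omega_quot b"] by simp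
  then have l: "l = k" by (simp add: a b)
  let ?S = "welter_section as k - {m}"
  define K where "K = omega_quot ` set as"
  have k: "k \<in> K" "finite K"
    using imageI[OF nth_mem[OF i(1)], of omega_quot] by (simp_all add: K_def a)
  have "omega_quot ` set bs \<subseteq> K"
    using k(1) set_update_subset_insert[of as i b] by (auto simp: i(4) b l K_def)
  then have "nim_sum_nat (\<lambda>j. welter_nat (welter_section bs j)) K
      = nim_sum_nat (\<lambda>j. welter_nat (welter_section as j)) K"
    using sections section_sum_superset[OF k(2)] by (simp add: K_def)
  moreover have "nim_sum_nat (\<lambda>j. welter_nat (welter_section bs j)) (K - {k})
      = nim_sum_nat (\<lambda>j. welter_nat (welter_section as j)) (K - {k})"
    by (rule nim.cong) (auto simp: i(4) b l welter_section_update[OF assms(1) i(1) a])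
  ultimately have "welter_nat (welter_section bs k) = welter_nat (welter_section as k)"
    unfolding nim.remove[OF k(2,1)] by (metis xor_cancel xor.commute)
  moreover have "welter_section bs k = insert n ?S"
    by (simp add: i(4) b l welter_section_update[OF assms(1) i(1) a])
  moreover have "m \<in> welter_section as k"
    using nth_mem[OF i(1)] by (simp add: mem_welter_section a)
  then have "welter_section as k = insert m ?S" by blast
  ultimately have "welter_nat (insert n ?S) = welter_nat (insert m ?S)" by simp
  moreover have "finite ?S" "m \<notin> ?S" by simp_all
  moreover have "n \<notin> ?S" using i(3) by (simp add: mem_welter_section b l)
  ultimately have "n = m" using welter_nat_insert_inj[of ?S n m] by blast
  then show False using i(2) by (simp add: a b l)
qed

text \<open>
  The sections form a Nim position with heaps \<open>[S\<^sub>\<lambda>]\<close>: one of these has to be lowered, and a move of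
  the finite game in that section does it.
\<close>
lemma welter_finite_move:
  assumes "distinct as" "v < section_sum as"
  obtains bs where "legal_move as bs" "welter bs = ord_omega * nim_sum (map omega_quot as) + ord_of_nat v"
proof -
  define K where "K = omega_quot ` set as"
  have K: "finite K" by (simp add: K_def)
  let ?w = "\<lambda>j. welter_nat (welter_section as j)"
  have T: "section_sum as = nim_sum_nat ?w K"
    by (rule section_sum_superset) (simp_all add: K_def)
  obtain k where k: "k \<in> K" "?w k XOR (v XOR nim_sum_nat ?w K) < ?w k"
    using assms(2) nim_sum_nat_lessE[OF K] unfolding T by blast
  obtain m n where mn: "m \<in> welter_section as k" "n < m" "n \<notin> welter_section as k"
    "welter_nat (insert n (welter_section as k - {m})) = ?w k XOR (v XOR nim_sum_nat ?w K)"
    using k(2) by (rule welter_nat_move[OF finite_welter_section])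
  obtain i where i: "i < length as" "as ! i = ord_omega * k + ord_of_nat m"
    using mn(1) by (auto simp: mem_welter_section in_set_conv_nth)
  define b where "b = ord_omega * k + ord_of_nat n"
  let ?bs = "as[i := b]"
  have "legal_move as ?bs"
    using i mn by (intro legal_moveI) (auto simp: b_def omega_less_iff mem_welter_section)
  moreover have "welter ?bs = ord_omega * nim_sum (map omega_quot as) + ord_of_nat v"
  proof -
    have "map omega_quot ?bs = map omega_quot as"
      using i by (intro nth_equalityI) (auto simp: b_def nth_list_update)
    moreover have "omega_quot ` set ?bs \<subseteq> K"
      using k(1) set_update_subset_insert[of as i b] by (auto simp: b_def K_def)
    then have "section_sum ?bs = nim_sum_nat (\<lambda>j. welter_nat (welter_section ?bs j)) K"
      by (rule section_sum_superset[OF K])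
    moreover have "nim_sum_nat (\<lambda>j. welter_nat (welter_section ?bs j)) (K - {k})
        = nim_sum_nat ?w (K - {k})"
      by (rule nim.cong) (auto simp: b_def welter_section_update[OF assms(1) i])
    moreover have "welter_section ?bs k = insert n (welter_section as k - {m})"
      by (simp add: b_def welter_section_update[OF assms(1) i])
    ultimately have "section_sum ?bs = v"
      using mn(4) by (simp add: nim.remove[OF K k(1)] xor_ac)
    with \<open>map omega_quot ?bs = map omega_quot as\<close> show ?thesis by (simp add: welter_eq)
  qed
  ultimately show thesis by (rule that)
qed

text \<open>
  The Nim move on the quotients prescribes the coin and its new section \<open>l\<close>. All squares of
  that section lie below the coin, so the remainder can be chosen to give any finite part \<open>v\<close>.
\<close>
lemma welter_transfinite_move:
  assumes "distinct as" "\<mu> < nim_sum (map omega_quot as)"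
  obtains bs where "legal_move as bs" "welter bs = ord_omega * \<mu> + ord_of_nat v"
proof -
  obtain i l where i: "i < length (map omega_quot as)" "l < map omega_quot as ! i"
    and l: "nim_sum ((map omega_quot as)[i := l]) = \<mu>"
    using assms(2) by (rule nim_sum_move)
  then have i: "i < length as" "l < omega_quot (as ! i)" by simp_all
  obtain k m where a: "as ! i = ord_omega * k + ord_of_nat m" using omega_decomposition by metis
  with i(2) have "l < k" by simp
  define K where "K = insert l (omega_quot ` set as)"
  have K: "finite K" "l \<in> K" by (simp_all add: K_def)
  \<comment> \<open>The contribution of the sections other than \<open>l\<close> after the coin has left section \<open>k\<close>.\<close>
  define r where "r = nim_sum_nat
    (\<lambda>j. welter_nat (welter_section as j - (if j = k then {m} else {}))) (K - {l})"
  obtain n where n: "n \<notin> welter_section as l"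
    "welter_nat (insert n (welter_section as l)) = v XOR r"
    by (rule welter_nat_insert_surj[OF finite_welter_section])
  define b where "b = ord_omega * l + ord_of_nat n"
  let ?bs = "as[i := b]"
  have "legal_move as ?bs"
    using i(1) a n(1) \<open>l < k\<close>
    by (intro legal_moveI) (auto simp: b_def omega_less_iff mem_welter_section)
  moreover have "welter ?bs = ord_omega * \<mu> + ord_of_nat v"
  proof -
    have "omega_quot ` set ?bs \<subseteq> K"
      using set_update_subset_insert[of as i b] by (auto simp: b_def K_def)
    then have "section_sum ?bs = nim_sum_nat (\<lambda>j. welter_nat (welter_section ?bs j)) K"
      by (rule section_sum_superset[OF K(1)])
    moreover have "nim_sum_nat (\<lambda>j. welter_nat (welter_section ?bs j)) (K - {l}) = r"
      unfolding r_def by (rule nim.cong) (auto simp: b_def welter_section_update[OF assms(1) i(1) a])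
    moreover have "welter_section ?bs l = insert n (welter_section as l)"
      using \<open>l < k\<close> by (simp add: b_def welter_section_update[OF assms(1) i(1) a])
    ultimately have "section_sum ?bs = v"
      using n(2) by (simp add: nim.remove[OF K] xor_ac)
    then show ?thesis using l by (simp add: welter_eq map_update b_def)
  qed
  ultimately show thesis by (rule that)
qed

lemma welter_move:
  assumes "distinct as" "\<beta> < welter as"
  obtains bs where "legal_move as bs" "welter bs = \<beta>"
proof -
  obtain \<mu> v where \<beta>: "\<beta> = ord_omega * \<mu> + ord_of_nat v" using omega_decomposition by metis
  then consider "\<mu> < nim_sum (map omega_quot as)"
    | "\<mu> = nim_sum (map omega_quot as)" "v < section_sum as"
    using assms(2) by (auto simp: welter_eq omega_less_iff)
  then show thesis
  proof cases
    case 1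
    then show thesis using that \<beta> welter_transfinite_move[OF assms(1)] by metis
  next
    case 2
    then show thesis using that \<beta> welter_finite_move[OF assms(1)] by metis
  qed
qed

theorem theorem2p9:
  fixes \<alpha>s :: "'a ordinal list"
  assumes "welter_position \<alpha>s"
  shows "grundy \<alpha>s = welter \<alpha>s"
  using assms
proof (induction \<alpha>s rule: grundy.induct)
  case (1 \<alpha>s)
  have "grundy ` {\<beta>s. legal_move \<alpha>s \<beta>s} = welter ` {\<beta>s. legal_move \<alpha>s \<beta>s}"
    using 1 welter_position_legal_move by (intro image_cong) auto
  moreover have "mex (welter ` {\<beta>s. legal_move \<alpha>s \<beta>s}) = welter \<alpha>s"
    using "1.prems" unfolding welter_position_def
    by (intro mex_eqI) (auto dest: welter_legal_move_neq elim: welter_move)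
  ultimately show ?case by (simp only: grundy_eq_mex[of \<alpha>s])
qed

end
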